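(* Let $E=C([-2,0])$ and let $A$ be given by $D(A)=\{f\in C^1([-2,0]):f'(0)=f(-2)-f(-1)\}$, $Af=f'$. Then $A$ generates a $C_0$-semigroup $(e^{tA})_{t\ge0}$ on $E$, and: (i) $A$ has compact resolvent, and $s(A)=0$ is a dominant spectral value; (ii) $s(A)$ is an algebraically simple eigenvalue of $A$ and the associated spectral projection $P$ is positive; (iii) $(e^{tA})_{t\ge0}$ is uniformly asymptotically positive, but it is neither positive nor individually eventually strongly positive with respect to any quasi-interior point of $E_+$.
   Context: $C([-2,0])$ is the complex Banach lattice with sup norm and pointwise order; $d_+(f)=\operatorname{dist}(f,E_+)$; $s(A)$ is the spectral bound, dominant meaning $\sigma(A)\cap(s(A)+i\mathbb{R})=\{s(A)\}$. Uniformly asymptotically positive: $(e^{t(A-s(A))})$ is bounded and for every $\varepsilon>0$ there is $t_0$ with $d_+(e^{t(A-s(A))}f)\le\varepsilon\|f\|$ for all $t\ge t_0$, $f\in E_+$. $u\in E_+$ is quasi-interior if $\{f:|f|\le cu\text{ for some } c\}$ is dense; the semigroup is individually eventually strongly positive with respect to $u$ if for each $f\ge0$, $f\ne0$, there is $t_0>0$ such that for all $t\ge t_0$, $e^{tA}f\ge cu$ for some $c>0$. *)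

theory Defs
  imports "HOL-Complex_Analysis.Complex_Analysis"
begin

text \<open>The complex Banach lattice E = C([-2,0]).  Elements are represented by
functions real => complex that are continuous on [-2,0] and vanish outside
[-2,0] (canonical representatives).\<close>

definition Ecar :: "(real \<Rightarrow> complex) set" where
  "Ecar = {f. continuous_on {-2..0} f \<and> (\<forall>x. x \<notin> {-2..0} \<longrightarrow> f x = 0)}"

definition supn :: "(real \<Rightarrow> complex) \<Rightarrow> real" where
  "supn f = (SUP x\<in>{-2..0}. cmod (f x))"

definition nonneg :: "(real \<Rightarrow> complex) \<Rightarrow> bool" where
  "nonneg f \<longleftrightarrow> (\<forall>x\<in>{-2..0}. Im (f x) = 0 \<and> 0 \<le> Re (f x))"

definition Eplus :: "(real \<Rightarrow> complex) set" where
  "Eplus = {f \<in> Ecar. nonneg f}"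

definition dplus :: "(real \<Rightarrow> complex) \<Rightarrow> real" where
  "dplus f = (INF g\<in>Eplus. supn (\<lambda>x. f x - g x))"

definition bounded_opE :: "((real \<Rightarrow> complex) \<Rightarrow> (real \<Rightarrow> complex)) \<Rightarrow> bool" where
  "bounded_opE T \<longleftrightarrow>
     (\<forall>f\<in>Ecar. T f \<in> Ecar) \<and>
     (\<forall>f\<in>Ecar. \<forall>g\<in>Ecar. T (\<lambda>x. f x + g x) = (\<lambda>x. T f x + T g x)) \<and>
     (\<forall>f\<in>Ecar. \<forall>c. T (\<lambda>x. c * f x) = (\<lambda>x. c * T f x)) \<and>
     (\<exists>M. \<forall>f\<in>Ecar. supn (T f) \<le> M * supn f)"

definition positive_opE :: "((real \<Rightarrow> complex) \<Rightarrow> (real \<Rightarrow> complex)) \<Rightarrow> bool" where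
  "positive_opE T \<longleftrightarrow> (\<forall>f\<in>Eplus. nonneg (T f))"

text \<open>Compact operator: maps bounded sequences to sequences having a Cauchy
(hence, E being complete, convergent) subsequence.\<close>
definition compact_opE :: "((real \<Rightarrow> complex) \<Rightarrow> (real \<Rightarrow> complex)) \<Rightarrow> bool" where
  "compact_opE T \<longleftrightarrow> bounded_opE T \<and>
     (\<forall>u::nat \<Rightarrow> real \<Rightarrow> complex. (\<forall>n. u n \<in> Ecar) \<and> (\<exists>B. \<forall>n. supn (u n) \<le> B) \<longrightarrow>
        (\<exists>r::nat \<Rightarrow> nat. strict_mono r \<and>
           (\<forall>e>0. \<exists>N. \<forall>m\<ge>N. \<forall>n\<ge>N. supn (\<lambda>x. T (u (r m)) x - T (u (r n)) x) < e)))"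

definition C0_semigroup :: "(real \<Rightarrow> (real \<Rightarrow> complex) \<Rightarrow> (real \<Rightarrow> complex)) \<Rightarrow> bool" where
  "C0_semigroup T \<longleftrightarrow>
     (\<forall>t\<ge>0. bounded_opE (T t)) \<and>
     (\<forall>f\<in>Ecar. T 0 f = f) \<and>
     (\<forall>s\<ge>0. \<forall>t\<ge>0. \<forall>f\<in>Ecar. T (s + t) f = T s (T t f)) \<and>
     (\<forall>f\<in>Ecar. ((\<lambda>t. supn (\<lambda>x. T t f x - f x)) \<longlongrightarrow> 0) (at_right 0))"

definition is_generator ::
  "(real \<Rightarrow> (real \<Rightarrow> complex) \<Rightarrow> (real \<Rightarrow> complex)) \<Rightarrow> (real \<Rightarrow> complex) set
     \<Rightarrow> ((real \<Rightarrow> complex) \<Rightarrow> (real \<Rightarrow> complex)) \<Rightarrow> bool" where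
  "is_generator T D Aop \<longleftrightarrow>
     D = {f \<in> Ecar. \<exists>g\<in>Ecar.
            ((\<lambda>h. supn (\<lambda>x. (T h f x - f x) / complex_of_real h - g x)) \<longlongrightarrow> 0) (at_right 0)} \<and>
     (\<forall>f\<in>D. Aop f \<in> Ecar \<and>
            ((\<lambda>h. supn (\<lambda>x. (T h f x - f x) / complex_of_real h - Aop f x)) \<longlongrightarrow> 0) (at_right 0))"

definition resolventE ::
  "(real \<Rightarrow> complex) set \<Rightarrow> ((real \<Rightarrow> complex) \<Rightarrow> (real \<Rightarrow> complex)) \<Rightarrow> complex
     \<Rightarrow> (real \<Rightarrow> complex) \<Rightarrow> (real \<Rightarrow> complex)" where
  "resolventE D Aop \<mu> g = (THE f. f \<in> D \<and> (\<forall>x. \<mu> * f x - Aop f x = g x))"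

definition resolvent_setE ::
  "(real \<Rightarrow> complex) set \<Rightarrow> ((real \<Rightarrow> complex) \<Rightarrow> (real \<Rightarrow> complex)) \<Rightarrow> complex set" where
  "resolvent_setE D Aop = {\<mu>. (\<forall>g\<in>Ecar. \<exists>!f. f \<in> D \<and> (\<forall>x. \<mu> * f x - Aop f x = g x))
                             \<and> bounded_opE (resolventE D Aop \<mu>)}"

definition spectrum_op ::
  "(real \<Rightarrow> complex) set \<Rightarrow> ((real \<Rightarrow> complex) \<Rightarrow> (real \<Rightarrow> complex)) \<Rightarrow> complex set" where
  "spectrum_op D Aop = UNIV - resolvent_setE D Aop"

text \<open>Spectral bound (in the extended reals, so that it is always defined).\<close>
definition spectral_bound ::
  "(real \<Rightarrow> complex) set \<Rightarrow> ((real \<Rightarrow> complex) \<Rightarrow> (real \<Rightarrow> complex)) \<Rightarrow> ereal" where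
  "spectral_bound D Aop = (SUP z\<in>spectrum_op D Aop. ereal (Re z))"

definition has_compact_resolvent ::
  "(real \<Rightarrow> complex) set \<Rightarrow> ((real \<Rightarrow> complex) \<Rightarrow> (real \<Rightarrow> complex)) \<Rightarrow> bool" where
  "has_compact_resolvent D Aop \<longleftrightarrow>
     (\<exists>\<mu>\<in>resolvent_setE D Aop. compact_opE (resolventE D Aop \<mu>))"

definition dominant_spectral_bound ::
  "(real \<Rightarrow> complex) set \<Rightarrow> ((real \<Rightarrow> complex) \<Rightarrow> (real \<Rightarrow> complex)) \<Rightarrow> bool" where
  "dominant_spectral_bound D Aop \<longleftrightarrow>
     (\<exists>s::real. spectral_bound D Aop = ereal s \<and>
        spectrum_op D Aop \<inter> {z. Re z = s} = {complex_of_real s})"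

text \<open>Riesz spectral projection for the isolated spectral value mu0, computed
with the circle of radius r (evaluated pointwise; point evaluations are
continuous linear functionals on E).\<close>
definition spectral_proj ::
  "(real \<Rightarrow> complex) set \<Rightarrow> ((real \<Rightarrow> complex) \<Rightarrow> (real \<Rightarrow> complex)) \<Rightarrow> complex \<Rightarrow> real
     \<Rightarrow> (real \<Rightarrow> complex) \<Rightarrow> (real \<Rightarrow> complex)" where
  "spectral_proj D Aop \<mu>0 r f = (\<lambda>x.
      contour_integral (circlepath \<mu>0 r) (\<lambda>\<mu>. resolventE D Aop \<mu> f x) / (2 * complex_of_real pi * \<i>))"

definition alg_simple_eigenvalue ::
  "(real \<Rightarrow> complex) set \<Rightarrow> ((real \<Rightarrow> complex) \<Rightarrow> (real \<Rightarrow> complex)) \<Rightarrow> complex \<Rightarrow> bool" where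
  "alg_simple_eigenvalue D Aop \<mu>0 \<longleftrightarrow>
     (\<exists>f\<in>D. f \<noteq> (\<lambda>x. 0) \<and> (\<forall>x. Aop f x = \<mu>0 * f x)) \<and>
     (\<exists>r>0. cball \<mu>0 r \<inter> spectrum_op D Aop = {\<mu>0}) \<and>
     (\<forall>r>0. cball \<mu>0 r \<inter> spectrum_op D Aop = {\<mu>0} \<longrightarrow>
        (\<exists>u\<in>Ecar. u \<noteq> (\<lambda>x. 0) \<and> (\<exists>f\<in>Ecar. spectral_proj D Aop \<mu>0 r f = u) \<and>
           (\<forall>f\<in>Ecar. \<exists>c. spectral_proj D Aop \<mu>0 r f = (\<lambda>x. c * u x))))"

definition positive_spectral_proj ::
  "(real \<Rightarrow> complex) set \<Rightarrow> ((real \<Rightarrow> complex) \<Rightarrow> (real \<Rightarrow> complex)) \<Rightarrow> complex \<Rightarrow> bool" where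
  "positive_spectral_proj D Aop \<mu>0 \<longleftrightarrow>
     (\<forall>r>0. cball \<mu>0 r \<inter> spectrum_op D Aop = {\<mu>0} \<longrightarrow>
        positive_opE (spectral_proj D Aop \<mu>0 r))"

definition unif_asym_positive ::
  "(real \<Rightarrow> (real \<Rightarrow> complex) \<Rightarrow> (real \<Rightarrow> complex)) \<Rightarrow> real \<Rightarrow> bool" where
  "unif_asym_positive T s \<longleftrightarrow>
     (\<exists>M. \<forall>t\<ge>0. \<forall>f\<in>Ecar. supn (\<lambda>x. exp (- s * t) * T t f x) \<le> M * supn f) \<and>
     (\<forall>\<epsilon>>0. \<exists>t0. \<forall>t\<ge>t0. \<forall>f\<in>Eplus.
         dplus (\<lambda>x. exp (- s * t) * T t f x) \<le> \<epsilon> * supn f)"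

definition quasi_interior :: "(real \<Rightarrow> complex) \<Rightarrow> bool" where
  "quasi_interior u \<longleftrightarrow> u \<in> Eplus \<and>
     (\<forall>g\<in>Ecar. \<forall>\<epsilon>>0. \<exists>f\<in>Ecar.
        (\<exists>c. \<forall>x\<in>{-2..0}. cmod (f x) \<le> c * Re (u x)) \<and> supn (\<lambda>x. g x - f x) < \<epsilon>)"

definition indiv_ev_strongly_positive ::
  "(real \<Rightarrow> (real \<Rightarrow> complex) \<Rightarrow> (real \<Rightarrow> complex)) \<Rightarrow> (real \<Rightarrow> complex) \<Rightarrow> bool" where
  "indiv_ev_strongly_positive T u \<longleftrightarrow>
     (\<forall>f\<in>Eplus. f \<noteq> (\<lambda>x. 0) \<longrightarrow>
        (\<exists>t0>0. \<forall>t\<ge>t0. \<exists>c>0. nonneg (\<lambda>x. T t f x - complex_of_real c * u x)))"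

definition DA :: "(real \<Rightarrow> complex) set" where
  "DA = {f \<in> Ecar.
          (\<forall>x\<in>{-2..0}. f differentiable (at x within {-2..0})) \<and>
          continuous_on {-2..0} (\<lambda>x. vector_derivative f (at x within {-2..0})) \<and>
          vector_derivative f (at 0 within {-2..0}) = f (-2) - f (-1)}"

definition opA :: "(real \<Rightarrow> complex) \<Rightarrow> (real \<Rightarrow> complex)" where
  "opA f = (\<lambda>x. if x \<in> {-2..0} then vector_derivative f (at x within {-2..0}) else 0)"

end

theory Submission
  imports Defs
begin

text \<open>The semigroup shifts along solutions of \<open>u'(t) = u(t - 2) - u(t - 1)\<close>.  This equation conserves
  \<open>K = u(t) + \<integral>\<^bsub>t-2\<^esub>\<^bsup>t-1\<^esup> u\<close>, so \<open>u\<close> solves the renewal equation \<open>u(t) = K - \<integral>\<^bsub>t-2\<^esub>\<^bsup>t-1\<^esup> u\<close> and the deviation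
  \<open>w = u - K/2\<close> satisfies \<open>w(t) = - \<integral>\<^bsub>t-2\<^esub>\<^bsup>t-1\<^esup> w\<close>.  A Lipschitz argument turns this into a strict contraction of
  the supremum of \<open>\<bar>w\<bar>\<close>, whence orbits converge to the constant \<open>K/2\<close>, uniformly on the unit ball; this is
  the spectral projection, and it is positive.  On its kernel the same identity forbids \<open>w \<ge> 0\<close> unless \<open>w\<close> vanishes, and the
  kernel contains a nonzero positive function, which excludes positivity and strong positivity.  The resolvent is explicit, its poles being the zeros of
  \<open>\<mu> - exp (-2\<mu>) + exp (-\<mu>)\<close>.\<close>

subsection \<open>Uniqueness of semigroups with a given generator\<close>

text \<open>The theorem speaks of every semigroup generated by \<open>opA\<close>, while the
  estimates concern one explicit semigroup, so uniqueness must be proved.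
  \<open>C0_semigroup\<close> bounds each operator separately; a Baire argument supplies the
  uniformity near time 0. Since \<open>Ecar\<close> is a set of functions and not a type, the
  uniqueness argument runs in an ambient Banach space.

  The bare identity for w only says that |w(t)| is at most the mean of |w| over a window of length
  1, which keeps the supremum from growing but does not shrink it; the decay comes from playing two
  consecutive windows against each other. The rate is thus explicit, and nothing about the long-time
  behaviour is read off the spectrum.

  Both halves meet in the number K/2. A constant c has K = 2c, its value plus a window of length
  one; on the spectral side, 2 is the derivative of the characteristic function at 0, so the residue
  of the resolvent is again K/2.\<close>

lemma uniform_boundedness_principle:
  fixes F :: "'i \<Rightarrow> 'a::banach \<Rightarrow> 'b::real_normed_vector"
  assumes lin: "\<And>i. i \<in> I \<Longrightarrow> bounded_linear (F i)"
    and bd: "\<And>x. \<exists>B. \<forall>i\<in>I. norm (F i x) \<le> B"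
  shows "\<exists>M. \<forall>i\<in>I. \<forall>x. norm (F i x) \<le> M * norm x"
proof -
  define C where "C n = {x. \<forall>i\<in>I. norm (F i x) \<le> real n}" for n
  have clC: "closed (C n)" for n
  proof -
    have "C n = (\<Inter>i\<in>I. {x. norm (F i x) \<le> real n})"
      by (auto simp: C_def)
    moreover have "closed {x. norm (F i x) \<le> real n}" if "i \<in> I" for i
      by (intro closed_Collect_le continuous_on_norm continuous_on_const
          linear_continuous_on lin that)
    ultimately show ?thesis by auto
  qed
  \<comment> \<open>Baire: the closed sets \<open>C n\<close> cover the space by the pointwise
    bounds, so they cannot all be nowhere dense.\<close>
  have "\<exists>n. interior (C n) \<noteq> {}"
  proof (rule ccontr)
    assume "\<not> ?thesis"
    then have "euclidean interior_of \<Union>(range C) = {}"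
      using clC by (intro Baire_category_alt) (auto simp: completely_metrizable_space_euclidean)
    moreover have "\<Union>(range C) = UNIV"
    proof -
      have "\<exists>n. x \<in> C n" for x
      proof -
        obtain B where "\<forall>i\<in>I. norm (F i x) \<le> B" using bd by blast
        moreover obtain n where "B \<le> real n" using real_arch_simple by blast
        ultimately show ?thesis unfolding C_def using order_trans by blast
      qed
      then show ?thesis by auto
    qed
    ultimately show False by simp
  qed
  then obtain n x0 where "x0 \<in> interior (C n)" by blast
  then obtain r where r: "r > 0" "cball x0 r \<subseteq> C n"
    by (meson mem_interior_cball)
  have "norm (F i x) \<le> (2 * real n / r) * norm x" if i: "i \<in> I" for i x
  proof (cases "x = 0")
    case False
    interpret bounded_linear "F i" using lin i .
    \<comment> \<open>Rescaling puts \<open>y\<close> on the sphere of radius \<open>r\<close>; then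
      \<open>F i y\<close> is a difference of two values at points of \<open>C n\<close>, whence the
      factor 2.\<close>
    define y where "y = (r / norm x) *\<^sub>R x"
    have "norm y = r" using r False by (simp add: y_def)
    then have "x0 + y \<in> C n" "x0 \<in> C n" using r by (auto simp: dist_norm)
    then have "norm (F i (x0 + y) - F i x0) \<le> real n + real n"
      unfolding C_def using i by (intro norm_triangle_le_diff) fastforce
    then have "(r / norm x) * norm (F i x) \<le> 2 * real n"
      using r by (simp add: add y_def scaleR)
    then show ?thesis using r False by (simp add: field_simps)
  qed (use bounded_linear.linear[OF lin[OF i]] in \<open>simp add: linear_0\<close>)
  then show ?thesis by blast
qed

text \<open>The operator \<open>T 0\<close> is only an idempotent, because functions on a subinterval will be
  embedded as a proper subspace of the bounded continuous functions on the line.\<close>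
locale degenerate_semigroup =
  fixes T :: "real \<Rightarrow> 'a::banach \<Rightarrow> 'a"
  assumes lin: "t \<ge> 0 \<Longrightarrow> bounded_linear (T t)"
    and mult: "s \<ge> 0 \<Longrightarrow> t \<ge> 0 \<Longrightarrow> T (s + t) x = T s (T t x)"
    and cont0: "((\<lambda>t. T t x) \<longlongrightarrow> T 0 x) (at_right 0)"
begin

text \<open>The quotient subtracts \<open>T 0 x\<close> instead of \<open>x\<close>: with a mere
  idempotent at time 0, \<open>T h x - x\<close> need not tend to 0.\<close>

definition gen :: "'a \<Rightarrow> 'a \<Rightarrow> bool" where
  "gen x y \<longleftrightarrow> ((\<lambda>h. (T h x - T 0 x) /\<^sub>R h) \<longlongrightarrow> y) (at_right 0)"

text \<open>If no uniform bound held near 0, one could pick times \<open>t n\<close> tending to 0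
  with \<open>T (t n)\<close> violating the bound n. Right continuity at 0 keeps each orbit bounded
  along these times, which contradicts the uniform boundedness principle.\<close>

lemma locally_bounded: "\<exists>d>0. \<exists>M. \<forall>t\<in>{0..d}. \<forall>x. norm (T t x) \<le> M * norm x"
proof (rule ccontr)
  assume "\<not> ?thesis"
  then have "\<exists>t\<in>{0..1 / real (Suc n)}. \<exists>x. \<not> norm (T t x) \<le> real n * norm x" for n
    by (metis of_nat_0_less_iff zero_less_Suc zero_less_divide_1_iff)
  then obtain t where t: "\<And>n. t n \<in> {0..1 / real (Suc n)}"
      and nb: "\<And>n. \<exists>x. \<not> norm (T (t n) x) \<le> real n * norm x" by metis
  have "\<exists>M. \<forall>n\<in>UNIV. \<forall>x. norm (T (t n) x) \<le> M * norm x"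
  proof (rule uniform_boundedness_principle)
    show "bounded_linear (T (t i))" for i using t[of i] by (intro lin) auto
    fix x
    have "eventually (\<lambda>s. dist (T s x) (T 0 x) < 1) (at_right 0)"
      using cont0[of x] by (rule tendstoD) simp
    then obtain b where b: "b > 0" "\<And>s. 0 < s \<Longrightarrow> s < b \<Longrightarrow> dist (T s x) (T 0 x) < 1"
      unfolding eventually_at_right_field by blast
    obtain N where N: "1 / real (Suc N) < b"
      using b(1) reals_Archimedean by (metis inverse_eq_divide)
    have "norm (T (t n) x) \<le> Max ((\<lambda>n. norm (T (t n) x)) ` {..N}) + (norm (T 0 x) + 1)" for n
    proof (cases "n \<le> N")
      case True
      then have "norm (T (t n) x) \<le> Max ((\<lambda>n. norm (T (t n) x)) ` {..N})"
        by (intro Max_ge) auto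
      then show ?thesis using norm_ge_zero[of "T 0 x"] by linarith
    next
      case False
      have "1 / real (Suc n) \<le> 1 / real (Suc N)" using False by (simp add: field_simps)
      then have *: "0 \<le> t n" "t n < b" using t[of n] N by auto
      have "dist (T (t n) x) (T 0 x) < 1"
      proof (cases "t n = 0")
        case False
        then show ?thesis using b(2)[of "t n"] * by simp
      qed simp
      then have "norm (T (t n) x) \<le> norm (T 0 x) + 1"
        by (smt (verit) dist_norm norm_triangle_sub)
      moreover have "0 \<le> Max ((\<lambda>n. norm (T (t n) x)) ` {..N})"
        by (rule order_trans[OF _ Max_ge[of _ "norm (T (t 0) x)"]]) auto
      ultimately show ?thesis by linarith
    qed
    then show "\<exists>B. \<forall>n\<in>UNIV. norm (T (t n) x) \<le> B" by blast
  qed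
  then obtain M where M: "\<And>n x. norm (T (t n) x) \<le> M * norm x" by blast
  obtain n where "M \<le> real n" using real_arch_simple by blast
  then have "norm (T (t n) x) \<le> real n * norm x" for x
    using M[of n x] by (meson mult_right_mono norm_ge_zero order_trans)
  then show False using nb by blast
qed

lemma bounded_on_interval: "\<exists>M\<ge>0. \<forall>t\<in>{0..a}. \<forall>x. norm (T t x) \<le> M * norm x"
proof -
  obtain d M0 where d: "d > 0" and M0: "\<And>t x. t \<in> {0..d} \<Longrightarrow> norm (T t x) \<le> M0 * norm x"
    using locally_bounded by blast
  define M where "M = max 1 M0"
  have M: "norm (T t x) \<le> M * norm x" if "t \<in> {0..d}" for t x
    using M0[OF that] by (smt (verit) M_def mult_right_mono norm_ge_zero)
  have M1: "M \<ge> 1" by (simp add: M_def)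
  have "norm (T t x) \<le> M ^ Suc n * norm x" if "t \<in> {0..real n * d}" for n t x
    using that
  proof (induction n arbitrary: t x)
    case 0
    then show ?case using M[of t x] d by auto
  next
    case (Suc n)
    show ?case
    proof (cases "t \<le> real n * d")
      case True
      then have "norm (T t x) \<le> M ^ Suc n * norm x" using Suc by auto
      also have "\<dots> \<le> M ^ Suc (Suc n) * norm x"
        using M1 by (intro mult_right_mono power_increasing) auto
      finally show ?thesis .
    next
      case False
      define s where "s = t - real n * d"
      have s: "s \<in> {0..d}" using Suc.prems False by (auto simp: s_def algebra_simps)
      have "T t x = T s (T (real n * d) x)"
        using mult[of s "real n * d" x] s d by (simp add: s_def)
      then have "norm (T t x) \<le> M * norm (T (real n * d) x)" using M[OF s] by simp
      also have "\<dots> \<le> M * (M ^ Suc n * norm x)"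
        using Suc.IH[of "real n * d" x] d M1 by (intro mult_left_mono) auto
      finally show ?thesis by (simp add: mult.assoc)
    qed
  qed
  moreover obtain n where "a / d \<le> real n" using real_arch_simple by blast
  ultimately show ?thesis
    using d M1 by (intro exI[of _ "M ^ Suc n"]) (auto simp: field_simps)
qed

lemma absorb: "t \<ge> 0 \<Longrightarrow> T t (T 0 x) = T t x" "t \<ge> 0 \<Longrightarrow> T 0 (T t x) = T t x"
  using mult[of t 0 x] mult[of 0 t x] by auto

lemma strongly_continuous: "continuous_on {0..} (\<lambda>t. T t x)"
  unfolding continuous_on_iff
proof (intro ballI allI impI)
  fix t e :: real assume t: "t \<in> {0..}" and e: "e > 0"
  obtain M where M: "M \<ge> 0" "\<And>s x. s \<in> {0..t + 1} \<Longrightarrow> norm (T s x) \<le> M * norm x"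
    using bounded_on_interval by blast
  have "eventually (\<lambda>s. dist (T s x) (T 0 x) < e / (M + 1)) (at_right 0)"
    using cont0[of x] by (rule tendstoD) (use e M in auto)
  then obtain b where b: "b > 0" "\<And>s. 0 < s \<Longrightarrow> s < b \<Longrightarrow> dist (T s x) (T 0 x) < e / (M + 1)"
    unfolding eventually_at_right_field by blast
  \<comment> \<open>The earlier time \<open>s\<close> is always factored out, so right continuity at
    0 yields both one-sided limits; the price is a bound on \<open>T s\<close> uniform over an
    interval.\<close>
  have key: "norm (T r x - T s x) < e" if "0 \<le> s" "s < r" "r - s < b" "s \<le> t + 1" for r s
  proof -
    interpret Ts: bounded_linear "T s" using that by (intro lin) auto
    have "T r x = T s (T (r - s) x)" using mult[of s "r - s" x] that by simp
    moreover have "T s x = T s (T 0 x)" using absorb(1) that by simp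
    ultimately have "norm (T r x - T s x) = norm (T s (T (r - s) x - T 0 x))"
      by (simp add: Ts.diff)
    also have "\<dots> \<le> M * norm (T (r - s) x - T 0 x)" using that by (intro M) auto
    also have "\<dots> \<le> M * (e / (M + 1))"
      using b(2)[of "r - s"] that M by (intro mult_left_mono) (auto simp: dist_norm)
    also have "\<dots> < e" using M e by (simp add: field_simps)
    finally show ?thesis .
  qed
  show "\<exists>d>0. \<forall>s\<in>{0..}. dist s t < d \<longrightarrow> dist (T s x) (T t x) < e"
  proof (intro exI[of _ "min b 1"] conjI ballI impI)
    fix s assume s: "s \<in> {0..}" "dist s t < min b 1"
    consider "s = t" | "s < t" | "t < s" by linarith
    then show "dist (T s x) (T t x) < e"
    proof cases
      case 2
      then show ?thesis using key[of s t] s by (simp add: dist_norm norm_minus_commute)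
    next
      case 3
      then show ?thesis using key[of t s] s t by (simp add: dist_norm)
    qed (use e in auto)
  qed (use b in auto)
qed

lemma gen_invariant:
  assumes "gen x y" "t \<ge> 0"
  shows "gen (T t x) (T t y)"
proof -
  interpret Tt: bounded_linear "T t" by (rule lin) fact
  have "((\<lambda>h. T t ((T h x - T 0 x) /\<^sub>R h)) \<longlongrightarrow> T t y) (at_right 0)"
    using assms(1) unfolding gen_def by (rule Tt.tendsto)
  moreover have "eventually (\<lambda>h. T t ((T h x - T 0 x) /\<^sub>R h)
       = (T h (T t x) - T 0 (T t x)) /\<^sub>R h) (at_right 0)"
    using eventually_at_right_less
  proof eventually_elim
    case (elim h)
    have "T t (T h x) = T h (T t x)"
      using mult[of t h x] mult[of h t x] elim assms(2) by (simp add: add.commute)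
    then show ?case using assms(2) by (simp add: Tt.scaleR Tt.diff absorb)
  qed
  ultimately show ?thesis unfolding gen_def by (rule Lim_transform_eventually)
qed

lemma gen_has_vector_derivative:
  assumes "gen x y" "t \<ge> 0"
  shows "((\<lambda>t. T t x) has_vector_derivative T t y) (at t within {0..})"
  unfolding has_vector_derivative_def has_derivative_within_alt
proof (intro conjI allI impI)
  show "bounded_linear (\<lambda>h. h *\<^sub>R T t y)" by (rule bounded_linear_scaleR_left)
  fix e :: real assume e: "e > 0"
  obtain M where M: "M \<ge> 0" "\<And>s x. s \<in> {0..t + 1} \<Longrightarrow> norm (T s x) \<le> M * norm x"
    using bounded_on_interval by blast
  have "eventually (\<lambda>h. dist ((T h x - T 0 x) /\<^sub>R h) y < e / 2 / (M + 1)) (at_right 0)"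
    using assms(1) unfolding gen_def by (rule tendstoD) (use e M in auto)
  then obtain b where b: "b > 0"
      "\<And>h. 0 < h \<Longrightarrow> h < b \<Longrightarrow> dist ((T h x - T 0 x) /\<^sub>R h) y < e / 2 / (M + 1)"
    unfolding eventually_at_right_field by blast
  obtain c where c: "c > 0" "\<And>s. s \<ge> 0 \<Longrightarrow> \<bar>s - t\<bar> < c \<Longrightarrow> norm (T s y - T t y) < e / 2"
    using strongly_continuous[of y] assms(2) e unfolding continuous_on_iff
    by (metis atLeast_iff dist_norm half_gt_zero real_norm_def)
  have key: "norm (T r x - T s x - (r - s) *\<^sub>R T s y) \<le> (e / 2) * (r - s)"
    if "0 \<le> s" "s < r" "r - s < b" "s \<le> t + 1" for r s
  proof -
    interpret Ts: bounded_linear "T s" using that by (intro lin) auto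
    define h where "h = r - s"
    have h: "0 < h" "h < b" using that by (auto simp: h_def)
    have "T r x = T s (T h x)" using mult[of s h x] that by (simp add: h_def)
    moreover have "T s x = T s (T 0 x)" using absorb(1) that by simp
    ultimately have "T r x - T s x - h *\<^sub>R T s y = T s (h *\<^sub>R ((T h x - T 0 x) /\<^sub>R h - y))"
      using h by (simp add: Ts.diff Ts.add Ts.scaleR algebra_simps)
    also have "norm \<dots> \<le> M * norm (h *\<^sub>R ((T h x - T 0 x) /\<^sub>R h - y))" using that by (intro M) auto
    also have "\<dots> \<le> M * (h * (e / 2 / (M + 1)))"
      unfolding norm_scaleR using b(2)[OF h] h M
      by (intro mult_left_mono mult_mono) (simp_all del: divide_divide_eq_left add: dist_norm)
    also have "\<dots> = (M / (M + 1)) * (e / 2 * h)" by (simp add: ac_simps)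
    also have "\<dots> \<le> e / 2 * h" using M e h by (intro mult_left_le_one_le) auto
    finally show ?thesis by (simp add: h_def)
  qed
  show "\<exists>d>0. \<forall>s\<in>{0..}. norm (s - t) < d \<longrightarrow>
      norm (T s x - T t x - (s - t) *\<^sub>R T t y) \<le> e * norm (s - t)"
  proof (intro exI[of _ "min (min b c) 1"] conjI ballI impI)
    fix s assume s: "s \<in> {0..}" "norm (s - t) < min (min b c) 1"
    consider "s = t" | "s < t" | "t < s" by linarith
    then show "norm (T s x - T t x - (s - t) *\<^sub>R T t y) \<le> e * norm (s - t)"
    proof cases
      case 2
      \<comment> \<open>For \<open>s < t\<close>, factoring out \<open>T s\<close> gives the slope
        \<open>T s y\<close> of the left end; strong continuity replaces it by
        \<open>T t y\<close>.\<close>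
      have "T s x - T t x - (s - t) *\<^sub>R T t y =
          - (T t x - T s x - (t - s) *\<^sub>R T s y) - (s - t) *\<^sub>R (T t y - T s y)"
        by (simp add: algebra_simps)
      also have "norm \<dots> \<le> norm (T t x - T s x - (t - s) *\<^sub>R T s y)
          + norm ((s - t) *\<^sub>R (T t y - T s y))"
        by (metis norm_minus_cancel norm_triangle_ineq4)
      also have "\<dots> \<le> (e / 2) * (t - s) + (t - s) * (e / 2)"
        using key[of s t] c(2)[of s] s 2
        by (intro add_mono) (auto intro!: mult_left_mono simp: norm_minus_commute)
      finally show ?thesis using 2 by simp
    next
      case 3
      then have "norm (T s x - T t x - (s - t) *\<^sub>R T t y) \<le> (e / 2) * (s - t)"
        using key[of t s] s assms(2) by auto
      also have "\<dots> \<le> e * (s - t)" using e 3 by (intro mult_right_mono) auto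
      finally show ?thesis using 3 by simp
    qed auto
  qed (use b c in auto)
qed

end

text \<open>Along \<open>\<phi> s = S (t - s) (T s x)\<close> the two contributions to the
  derivative cancel, because \<open>T s y\<close> is the generator value of \<open>T s x\<close> for
  both semigroups. Hence \<open>\<phi>\<close> is constant, and its end values are the two orbits.
  The families are only strongly continuous, so the product rule is carried out by hand.\<close>

lemma degenerate_semigroup_unique_on_domain:
  assumes S: "degenerate_semigroup S" and T: "degenerate_semigroup T"
    and zero: "\<And>x. S 0 x = T 0 x"
    and gen: "\<And>x y. degenerate_semigroup.gen T x y \<Longrightarrow> degenerate_semigroup.gen S x y"
    and xy: "degenerate_semigroup.gen T x y" and t: "t \<ge> 0"
  shows "S t x = T t x"
proof -
  interpret S: degenerate_semigroup S by fact
  interpret T: degenerate_semigroup T by fact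
  define \<phi> where "\<phi> s = S (t - s) (T s x)" for s
  have "(\<phi> has_vector_derivative 0) (at r within {0..t})" if r: "r \<in> {0..t}" for r
    unfolding has_vector_derivative_def has_derivative_within_alt
  proof (intro conjI allI impI)
    show "bounded_linear (\<lambda>h. h *\<^sub>R 0 :: 'a)" by (rule bounded_linear_scaleR_left)
    fix e :: real assume e: "e > 0"
    obtain M where M: "M \<ge> 0" "\<And>s x. s \<in> {0..t} \<Longrightarrow> norm (S s x) \<le> M * norm x"
      using S.bounded_on_interval by blast
    have eM: "e / 3 / (M + 1) > 0" using e M by simp
    have "((\<lambda>s. T s x) has_vector_derivative T r y) (at r within {0..})"
      using T.gen_has_vector_derivative[OF xy] r by simp
    then obtain d1 where d1: "d1 > 0" "\<And>s. s \<ge> 0 \<Longrightarrow> \<bar>s - r\<bar> < d1 \<Longrightarrow>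
        norm (T s x - T r x - (s - r) *\<^sub>R T r y) \<le> e / 3 / (M + 1) * \<bar>s - r\<bar>"
      using eM unfolding has_vector_derivative_def has_derivative_within_alt real_norm_def atLeast_iff
      by (metis atLeast_iff)
    have "S.gen (T r x) (T r y)"
      using gen T.gen_invariant[OF xy] r by simp
    then have "((\<lambda>s. S s (T r x)) has_vector_derivative S (t - r) (T r y)) (at (t - r) within {0..})"
      using S.gen_has_vector_derivative r by simp
    then obtain d2 where d2: "d2 > 0" "\<And>s. s \<ge> 0 \<Longrightarrow> \<bar>s - (t - r)\<bar> < d2 \<Longrightarrow>
        norm (S s (T r x) - S (t - r) (T r x) - (s - (t - r)) *\<^sub>R S (t - r) (T r y))
          \<le> e / 3 * \<bar>s - (t - r)\<bar>"
      using e unfolding has_vector_derivative_def has_derivative_within_alt real_norm_def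
      by (metis atLeast_iff divide_pos_pos zero_less_numeral)
    obtain d3 where d3: "d3 > 0" "\<And>s. s \<ge> 0 \<Longrightarrow> \<bar>s - (t - r)\<bar> < d3 \<Longrightarrow>
        norm (S s (T r y) - S (t - r) (T r y)) < e / 3"
      using S.strongly_continuous[of "T r y"] r e unfolding continuous_on_iff
      by (metis atLeastAtMost_iff atLeast_iff diff_ge_0_iff_ge dist_norm divide_pos_pos
          real_norm_def zero_less_numeral)
    show "\<exists>d>0. \<forall>s\<in>{0..t}. norm (s - r) < d \<longrightarrow>
        norm (\<phi> s - \<phi> r - (s - r) *\<^sub>R 0) \<le> e * norm (s - r)"
    proof (intro exI[of _ "min d1 (min d2 d3)"] conjI ballI impI)
      fix s assume s: "s \<in> {0..t}" "norm (s - r) < min d1 (min d2 d3)"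
      interpret Ss: bounded_linear "S (t - s)" using s by (intro S.lin) auto
      \<comment> \<open>\<open>a1\<close> is the remainder of the \<open>T\<close>-orbit transported
        by \<open>S\<close>, \<open>a2\<close> the error from strong continuity of \<open>S\<close>,
        and \<open>a3\<close> the remainder of the \<open>S\<close>-orbit; the first-order terms
        cancel in the sum.\<close>
      define a1 where "a1 = S (t - s) (T s x - T r x - (s - r) *\<^sub>R T r y)"
      define a2 where "a2 = (s - r) *\<^sub>R (S (t - s) (T r y) - S (t - r) (T r y))"
      define a3 where "a3 = S (t - s) (T r x) - S (t - r) (T r x)
          - ((t - s) - (t - r)) *\<^sub>R S (t - r) (T r y)"
      have "\<phi> s - \<phi> r - (s - r) *\<^sub>R 0 = a1 + a2 + a3"
        by (simp add: \<phi>_def a1_def a2_def a3_def Ss.diff Ss.add Ss.scaleR algebra_simps)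
      also have "norm \<dots> \<le> norm a1 + norm a2 + norm a3"
        by (meson add_mono_thms_linordered_semiring(3) norm_triangle_ineq norm_triangle_le)
      also have "\<dots> \<le> e / 3 * \<bar>s - r\<bar> + e / 3 * \<bar>s - r\<bar> + e / 3 * \<bar>s - r\<bar>"
      proof (intro add_mono)
        have "norm a1 \<le> M * norm (T s x - T r x - (s - r) *\<^sub>R T r y)"
          unfolding a1_def using s by (intro M) auto
        also have "\<dots> \<le> M * (e / 3 / (M + 1) * \<bar>s - r\<bar>)"
          using s M by (intro mult_left_mono d1) auto
        also have "\<dots> = (M / (M + 1)) * (e / 3 * \<bar>s - r\<bar>)" by simp
        also have "\<dots> \<le> e / 3 * \<bar>s - r\<bar>" using M e by (intro mult_left_le_one_le) auto
        finally show "norm a1 \<le> e / 3 * \<bar>s - r\<bar>" .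
        have "norm a2 = \<bar>s - r\<bar> * norm (S (t - s) (T r y) - S (t - r) (T r y))"
          by (simp add: a2_def)
        also have "\<dots> \<le> \<bar>s - r\<bar> * (e / 3)"
          using s by (intro mult_left_mono d3(2)[THEN less_imp_le]) auto
        finally show "norm a2 \<le> e / 3 * \<bar>s - r\<bar>" by (simp add: mult.commute)
        show "norm a3 \<le> e / 3 * \<bar>s - r\<bar>"
          unfolding a3_def using d2(2)[of "t - s"] s by (auto simp: abs_minus_commute)
      qed
      finally show "norm (\<phi> s - \<phi> r - (s - r) *\<^sub>R 0) \<le> e * norm (s - r)" by simp
    qed (use d1 d2 d3 in auto)
  qed
  then obtain c where "\<And>s. s \<in> {0..t} \<Longrightarrow> \<phi> s = c"
    using has_vector_derivative_zero_constant[of "{0..t}" \<phi>] by (metis convex_real_interval(5))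
  then have "\<phi> 0 = \<phi> t" using t by simp
  then have "S t (T 0 x) = S 0 (T t x)" by (simp add: \<phi>_def)
  then show ?thesis using t by (metis zero S.absorb(1) T.absorb(2))
qed

lemma degenerate_semigroup_unique:
  assumes S: "degenerate_semigroup S" and T: "degenerate_semigroup T"
    and zero: "\<And>x. S 0 x = T 0 x"
    and gen: "\<And>x y. degenerate_semigroup.gen T x y \<Longrightarrow> degenerate_semigroup.gen S x y"
    and x: "x \<in> closure {x. \<exists>y. degenerate_semigroup.gen T x y}" and t: "t \<ge> 0"
  shows "S t x = T t x"
proof -
  interpret S: degenerate_semigroup S by fact
  interpret T: degenerate_semigroup T by fact
  have "closed {x. S t x = T t x}"
    using S.lin[OF t] T.lin[OF t] by (intro closed_Collect_eq linear_continuous_on)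
  moreover have "{x. \<exists>y. T.gen x y} \<subseteq> {x. S t x = T t x}"
    using degenerate_semigroup_unique_on_domain[OF S T zero gen _ t] by blast
  ultimately show ?thesis using x closure_minimal by blast
qed

subsection \<open>The renewal equation\<close>

text \<open>Integrals over moving windows become differences of one antiderivative on the whole
  line, so shifting, differentiating and recombining windows is plain algebra.\<close>

lemma continuous_antiderivative:
  fixes g :: "real \<Rightarrow> complex"
  assumes "continuous_on UNIV g"
  shows "\<exists>G. (\<forall>x. (G has_vector_derivative g x) (at x)) \<and>
    (\<forall>a b. a \<le> b \<longrightarrow> integral {a..b} g = G b - G a)"
proof -
  obtain G where G: "\<And>x. (G has_vector_derivative g x) (at x)"
    using einterval_antiderivative[of "-\<infinity>" "\<infinity>" g] assms
    by (auto simp: continuous_on_eq_continuous_at)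
  moreover have "integral {a..b} g = G b - G a" if "a \<le> b" for a b
    using that G by (intro integral_unique fundamental_theorem_of_calculus)
      (auto intro: has_vector_derivative_at_within)
  ultimately show ?thesis by blast
qed

text \<open>A window is cut at \<open>m\<close>. On one piece \<open>w\<close> will be compared with
  its value at an end of the window; on the other the comparison value is 0, because only the bound
  on |w| is available there.\<close>

lemma integral_near_step_function:
  fixes w :: "real \<Rightarrow> complex"
  assumes w: "continuous_on {l..r} w" and m: "l \<le> m" "m \<le> r"
    and p: "\<And>s. s \<in> {l..m} \<Longrightarrow> cmod (w s - p) \<le> d"
    and q: "\<And>s. s \<in> {m..r} \<Longrightarrow> cmod (w s - q) \<le> e"
  shows "cmod (integral {l..r} w - of_real (m - l) * p - of_real (r - m) * q)
      \<le> d * (m - l) + e * (r - m)"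
proof -
  have c1: "continuous_on {l..m} w" "continuous_on {m..r} w"
    using w m by (auto intro: continuous_on_subset)
  have "integral {l..r} w = integral {l..m} w + integral {m..r} w"
    using w m by (intro Henstock_Kurzweil_Integration.integral_combine[symmetric] integrable_continuous_real) auto
  moreover have "integral {l..m} (\<lambda>s. w s - p) = integral {l..m} w - of_real (m - l) * p"
    using m c1 by (subst integral_diff) (auto intro: integrable_continuous_real simp: scaleR_conv_of_real)
  moreover have "integral {m..r} (\<lambda>s. w s - q) = integral {m..r} w - of_real (r - m) * q"
    using m c1 by (subst integral_diff) (auto intro: integrable_continuous_real simp: scaleR_conv_of_real)
  ultimately have "integral {l..r} w - of_real (m - l) * p - of_real (r - m) * q
      = integral {l..m} (\<lambda>s. w s - p) + integral {m..r} (\<lambda>s. w s - q)"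
    by simp
  also have "cmod \<dots> \<le> d * (m - l) + e * (r - m)"
    using m p q c1
    by (intro norm_triangle_mono integral_bound) (auto intro!: continuous_intros)
  finally show ?thesis .
qed

lemma vector_derivative_norm_bound:
  fixes f :: "real \<Rightarrow> 'a::real_normed_vector"
  assumes "convex S" and f: "\<And>x. x \<in> S \<Longrightarrow> (f has_vector_derivative f' x) (at x within S)"
    and B: "\<And>x. x \<in> S \<Longrightarrow> norm (f' x) \<le> B" and "x \<in> S" "y \<in> S"
  shows "norm (f x - f y) \<le> B * norm (x - y)"
proof (rule differentiable_bound[OF assms(1)])
  fix s assume s: "s \<in> S"
  show "(f has_derivative (\<lambda>h. h *\<^sub>R f' s)) (at s within S)"
    using f[OF s] by (simp add: has_vector_derivative_def)
  show "onorm (\<lambda>h. h *\<^sub>R f' s) \<le> B"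
    using B[OF s] order_trans[OF norm_ge_zero B[OF s]]
    by (intro onorm_bound) (auto simp: mult.commute[of B] intro: mult_left_mono)
qed (use assms in auto)

text \<open>The mean value inequality is applied to \<open>G s - s p(x)\<close>, whose derivative
  \<open>p s - p x\<close> is small by uniform continuity of \<open>p\<close>; steps shorter than 1
  stay inside \<open>{a..b + 1}\<close>.\<close>

lemma uniform_difference_quotient:
  fixes G :: "real \<Rightarrow> complex"
  assumes G: "\<And>x. (G has_vector_derivative p x) (at x)" and p: "continuous_on UNIV p"
    and e: "e > 0"
  obtains d where "d > 0"
    "\<And>h x. 0 < h \<Longrightarrow> h < d \<Longrightarrow> x \<in> {a..b} \<Longrightarrow>
      cmod ((G (x + h) - G x) / of_real h - p x) \<le> e"
proof -
  have "uniformly_continuous_on {a..b + 1} p"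
    using p by (intro compact_uniformly_continuous) (auto intro: continuous_on_subset)
  then obtain d where d: "d > 0"
    "\<And>x y. x \<in> {a..b + 1} \<Longrightarrow> y \<in> {a..b + 1} \<Longrightarrow> dist y x < d \<Longrightarrow> dist (p y) (p x) < e"
    using e unfolding uniformly_continuous_on_def by metis
  have "cmod ((G (x + h) - G x) / of_real h - p x) \<le> e"
    if h: "0 < h" "h < min d 1" and x: "x \<in> {a..b}" for h x
  proof -
    have "norm ((G (x + h) - (x + h) *\<^sub>R p x) - (G x - x *\<^sub>R p x)) \<le> e * norm (x + h - x)"
    proof (rule vector_derivative_norm_bound)
      fix s assume s: "s \<in> {x..x + h}"
      have "((\<lambda>s. G s - s *\<^sub>R p x) has_vector_derivative p s - 1 *\<^sub>R p x) (at s within {x..x + h})"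
        by (intro derivative_intros has_vector_derivative_at_within[OF G])
          (auto intro!: derivative_eq_intros)
      then show "((\<lambda>s. G s - s *\<^sub>R p x) has_vector_derivative p s - p x) (at s within {x..x + h})"
        by simp
      show "norm (p s - p x) \<le> e"
        using d(2)[of x s] s x h by (auto simp: dist_norm)
    qed (use h in auto)
    then have "cmod (G (x + h) - G x - of_real h * p x) \<le> e * h"
      using h by (simp add: algebra_simps scaleR_conv_of_real)
    moreover have "(G (x + h) - G x) / of_real h - p x = (G (x + h) - G x - of_real h * p x) / of_real h"
      using h by (simp add: field_simps)
    ultimately show ?thesis using h by (simp add: norm_divide field_simps)
  qed
  then show ?thesis using that[of "min d 1"] d by auto
qed

text \<open>Solutions of the delay equation \<open>v'(t) = v(t - 2) - v(t - 1)\<close> for \<open>t \<ge> 0\<close> conserve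
  \<open>v(t) + \<integral>\<^bsub>t-2\<^esub>\<^bsup>t-1\<^esup> v\<close>, and \<open>K\<close> is the conserved value.\<close>
definition renewal :: "complex \<Rightarrow> (real \<Rightarrow> complex) \<Rightarrow> bool" where
  "renewal K v \<longleftrightarrow> continuous_on UNIV v \<and> (\<forall>t\<ge>0. v t = K - integral {t - 2..t - 1} v)"

lemma renewal_integrable: "renewal K v \<Longrightarrow> v integrable_on {a..b}"
  by (auto simp: renewal_def intro: integrable_continuous_real continuous_on_subset)

lemma renewal_linear:
  assumes "renewal K v" "renewal L w"
  shows "renewal (a * K + b * L) (\<lambda>t. a * v t + b * w t)"
proof -
  have "integral {c..d} (\<lambda>t. a * v t + b * w t) = a * integral {c..d} v + b * integral {c..d} w" for c d
    using renewal_integrable[OF assms(1)] renewal_integrable[OF assms(2)]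
    by (subst integral_add) (auto intro!: integrable_on_mult_right)
  then show ?thesis
    using assms by (auto simp: renewal_def right_diff_distrib intro!: continuous_intros)
qed

lemma renewal_shift:
  assumes "renewal K v" "s \<ge> 0"
  shows "renewal K (\<lambda>t. v (s + t))"
proof -
  have c: "continuous_on UNIV v" using assms by (simp add: renewal_def)
  obtain G where G: "\<And>x. (G has_vector_derivative v x) (at x)"
      "\<And>a b. a \<le> b \<Longrightarrow> integral {a..b} v = G b - G a"
    using continuous_antiderivative[OF c] by blast
  have "((\<lambda>t. G (s + t)) has_vector_derivative 1 *\<^sub>R v (s + x)) (at x)" for x
  proof -
    have "((\<lambda>t. s + t) has_vector_derivative 1) (at x)" by (auto intro!: derivative_eq_intros)
    from vector_diff_chain_at[OF this G(1)] show ?thesis by (simp add: o_def)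
  qed
  then have "integral {a..b} (\<lambda>t. v (s + t)) = G (s + b) - G (s + a)" if "a \<le> b" for a b
    using that by (intro integral_unique fundamental_theorem_of_calculus)
      (auto intro: has_vector_derivative_at_within)
  moreover have "continuous_on UNIV (\<lambda>t. v (s + t))"
    by (rule continuous_on_compose2[OF c]) (auto intro!: continuous_intros)
  moreover have "v (s + t) = K - (G (s + t - 1) - G (s + t - 2))" if "t \<ge> 0" for t
    using assms that by (simp add: renewal_def G(2))
  ultimately show ?thesis
    by (simp add: renewal_def add_diff_eq)
qed

text \<open>The factor 2 is the value plus the integral over a window of length one. Subtracting the
  constant K/2 therefore reduces any solution to conserved value 0.\<close>

lemma renewal_const: "renewal (2 * c) (\<lambda>_. c)"
  by (auto simp: renewal_def)

lemma renewal_mass: "renewal K v \<Longrightarrow> K = v 0 + integral {-2..-1} v"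
  by (simp add: renewal_def)

lemma renewal_zero_bound:
  assumes w: "renewal 0 w" and M: "\<And>x. x \<in> {-2..0} \<Longrightarrow> cmod (w x) \<le> M" and x: "x \<ge> -2"
  shows "cmod (w x) \<le> M"
proof -
  have "\<forall>x\<in>{-2..real n}. cmod (w x) \<le> M" for n
  proof (induction n)
    case (Suc n)
    show ?case
    proof
      fix x assume x: "x \<in> {-2..real (Suc n)}"
      show "cmod (w x) \<le> M"
      proof (cases "x \<le> 0")
        case False
        then have "cmod (w x) = cmod (integral {x - 2..x - 1} w)"
          using w by (simp add: renewal_def)
        also have "\<dots> \<le> M * (x - 1 - (x - 2))"
          using Suc x False w
          by (intro integral_bound) (auto simp: renewal_def intro: continuous_on_subset)
        finally show ?thesis by simp
      qed (use M x in auto)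
    qed
  qed (use M in auto)
  moreover obtain n where "x \<le> real n" using real_arch_simple by blast
  ultimately show ?thesis using x by auto
qed

lemma renewal_zero_unique:
  assumes "renewal K v" "renewal L w" "\<And>x. x \<in> {-2..0} \<Longrightarrow> v x = w x" "x \<ge> -2"
  shows "v x = w x"
proof -
  have "integral {-2..-1} v = integral {-2..-1} w"
    using assms(3) by (intro integral_cong) auto
  then have "K = L" using renewal_mass[OF assms(1)] renewal_mass[OF assms(2)] assms(3)[of 0] by simp
  then have "renewal 0 (\<lambda>t. v t - w t)"
    using renewal_linear[OF assms(1,2), of 1 "-1"] by simp
  from renewal_zero_bound[OF this, of 0 x] have "cmod (v x - w x) \<le> 0" using assms(3,4) by simp
  then show ?thesis by simp
qed

text \<open>The averages of \<open>w\<close> over \<open>[t-2, t-1]\<close> and \<open>[t-3, t-2]\<close> are \<open>-w(t)\<close> and \<open>-w(t-1)\<close>.  By the Lipschitz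
  bound, \<open>\<bar>w(t)\<bar>\<close> close to \<open>M\<close> forces both \<open>w(t-2)\<close> and \<open>w(t-1)\<close> to be close to \<open>-w(t)\<close>, whereas the second
  average gives \<open>\<bar>w(t-2) + w(t-1)\<bar> \<le> 3M/2\<close>.\<close>
lemma renewal_zero_contraction:
  assumes w: "renewal 0 w" and T: "T \<ge> -2" and M: "\<And>x. x \<ge> T \<Longrightarrow> cmod (w x) \<le> M" and t: "t \<ge> T + 5"
  shows "cmod (w t) \<le> 127 / 128 * M"
proof -
  have c: "continuous_on S w" for S using w by (auto simp: renewal_def intro: continuous_on_subset)
  have eq: "w s = - integral {s - 2..s - 1} w" if "s \<ge> 0" for s
    using w that by (simp add: renewal_def)
  obtain G where G: "\<And>a b. a \<le> b \<Longrightarrow> integral {a..b} w = G b - G a"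
    using continuous_antiderivative[OF c] by blast
  have lip: "cmod (w s - w r) \<le> 2 * M * (s - r)" if "T + 2 \<le> r" "r \<le> s" for r s
  proof -
    have "w s - w r = integral {r - 2..s - 2} w - integral {r - 1..s - 1} w"
      using that T by (simp add: eq G)
    also have "cmod \<dots> \<le> M * ((s - 2) - (r - 2)) + M * ((s - 1) - (r - 1))"
      using that by (intro order_trans[OF norm_triangle_ineq4] add_mono integral_bound c M) auto
    finally show ?thesis by (simp add: algebra_simps)
  qed
  have M0: "M \<ge> 0" using M[of t] t by (smt (verit) norm_ge_zero)
  have lip': "cmod (w s - w r) \<le> 2 * M * e" if "T + 2 \<le> r" "T + 2 \<le> s" "\<bar>s - r\<bar> \<le> e" for r s e
  proof -
    have "cmod (w s - w r) \<le> 2 * M * \<bar>s - r\<bar>"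
      using lip[of r s] lip[of s r] that by (cases "r \<le> s") (auto simp: norm_minus_commute)
    also have "\<dots> \<le> 2 * M * e" using M0 that by (intro mult_left_mono) auto
    finally show ?thesis .
  qed
  have 1: "cmod (w (t - 1) + w (t - 2) / 2) \<le> M"
  proof -
    have "cmod (integral {t - 3..t - 2} w - of_real (t - 5/2 - (t - 3)) * 0
        - of_real (t - 2 - (t - 5/2)) * w (t - 2))
        \<le> M * (t - 5/2 - (t - 3)) + (2 * M * (1/2)) * (t - 2 - (t - 5/2))"
      by (intro integral_near_step_function c lip') (use M t in auto)
    moreover have "integral {t - 3..t - 2} w = - w (t - 1)"
      using eq[of "t - 1"] t T by (simp add: algebra_simps)
    moreover have "- w (t - 1) - w (t - 2) / 2 = - (w (t - 1) + w (t - 2) / 2)" by simp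
    ultimately show ?thesis by (simp del: minus_add_distrib)
  qed
  have 2: "cmod (w t + w (t - 1) / 16) \<le> M * (15/16) + M / 128"
  proof -
    have "cmod (integral {t - 2..t - 1} w - of_real (t - 17/16 - (t - 2)) * 0
        - of_real (t - 1 - (t - 17/16)) * w (t - 1))
        \<le> M * (t - 17/16 - (t - 2)) + (2 * M * (1/16)) * (t - 1 - (t - 17/16))"
      by (intro integral_near_step_function c lip') (use M t in auto)
    moreover have "integral {t - 2..t - 1} w = - w t"
      using eq[of t] t T by (simp add: algebra_simps)
    moreover have "- w t - w (t - 1) / 16 = - (w t + w (t - 1) / 16)" by simp
    ultimately show ?thesis by (simp del: minus_add_distrib)
  qed
  have 3: "cmod (w t + w (t - 2) / 16) \<le> M * (15/16) + M / 128"
  proof -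
    have "cmod (integral {t - 2..t - 1} w - of_real (t - 31/16 - (t - 2)) * w (t - 2)
        - of_real (t - 1 - (t - 31/16)) * 0)
        \<le> (2 * M * (1/16)) * (t - 31/16 - (t - 2)) + M * (t - 1 - (t - 31/16))"
      by (intro integral_near_step_function c lip') (use M t in auto)
    moreover have "integral {t - 2..t - 1} w = - w t"
      using eq[of t] t T by (simp add: algebra_simps)
    moreover have "- w t - w (t - 2) / 16 = - (w t + w (t - 2) / 16)" by simp
    ultimately show ?thesis by (simp del: minus_add_distrib)
  qed
  have 4: "cmod (w (t - 2)) \<le> M" using M t by simp
  have tri: "cmod (a + b - c - d) \<le> cmod a + cmod b + cmod c + cmod d" for a b c d
    using norm_triangle_ineq[of a b] norm_triangle_ineq4[of "a + b" c] norm_triangle_ineq4[of "a + b - c" d]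
    by linarith
  have "32 * w t = 16 * (w t + w (t - 1) / 16) + 16 * (w t + w (t - 2) / 16)
      - (w (t - 1) + w (t - 2) / 2) - w (t - 2) / 2" by simp
  then have "cmod (32 * w t) \<le> cmod (16 * (w t + w (t - 1) / 16)) + cmod (16 * (w t + w (t - 2) / 16))
      + cmod (w (t - 1) + w (t - 2) / 2) + cmod (w (t - 2) / 2)"
    by (simp only: tri)
  then have "32 * cmod (w t) \<le> 16 * cmod (w t + w (t - 1) / 16) + 16 * cmod (w t + w (t - 2) / 16)
      + cmod (w (t - 1) + w (t - 2) / 2) + cmod (w (t - 2)) / 2"
    unfolding norm_mult norm_divide by simp
  then show ?thesis using 1 2 3 4 by linarith
qed

lemma renewal_zero_decay:
  assumes w: "renewal 0 w" and M: "\<And>x. x \<in> {-2..0} \<Longrightarrow> cmod (w x) \<le> M"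
    and x: "x \<ge> 5 * real n - 2"
  shows "cmod (w x) \<le> (127 / 128) ^ n * M"
  using x
proof (induction n arbitrary: x)
  case 0
  then show ?case using renewal_zero_bound[OF w M] by simp
next
  case (Suc n)
  then show ?case
    using renewal_zero_contraction[OF w, of "5 * real n - 2" "(127 / 128) ^ n * M" x] by auto
qed

lemma renewal_has_vector_derivative:
  assumes v: "renewal K v" and t: "t \<ge> 0"
  shows "(v has_vector_derivative v (t - 2) - v (t - 1)) (at t within {0..})"
proof -
  have c: "continuous_on UNIV v" using v by (simp add: renewal_def)
  obtain G where G: "\<And>x. (G has_vector_derivative v x) (at x)"
      "\<And>a b. a \<le> b \<Longrightarrow> integral {a..b} v = G b - G a"
    using continuous_antiderivative[OF c] by blast
  have "((\<lambda>t. G (t - r)) has_vector_derivative 1 *\<^sub>R v (t - r)) (at t within {0..})" for r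
  proof -
    have "((\<lambda>t. t - r) has_vector_derivative 1) (at t)" by (auto intro!: derivative_eq_intros)
    from vector_diff_chain_at[OF this G(1)] show ?thesis
      by (simp add: o_def has_vector_derivative_at_within)
  qed
  then have "((\<lambda>t. K - G (t - 1) + G (t - 2)) has_vector_derivative 0 - 1 *\<^sub>R v (t - 1) + 1 *\<^sub>R v (t - 2))
      (at t within {0..})"
    by (intro derivative_intros)
  then have "((\<lambda>t. K - G (t - 1) + G (t - 2)) has_vector_derivative v (t - 2) - v (t - 1))
      (at t within {0..})" by simp
  then show ?thesis
    by (rule has_vector_derivative_transform[rotated 2])
      (use v t G in \<open>auto simp: renewal_def\<close>)
qed

subsection \<open>The solution semigroup\<close>

lemma EcarD: "f \<in> Ecar \<Longrightarrow> continuous_on {-2..0} f" "f \<in> Ecar \<Longrightarrow> x \<notin> {-2..0} \<Longrightarrow> f x = 0"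
  by (auto simp: Ecar_def)

lemma Ecar_restrictI:
  "continuous_on {-2..0} g \<Longrightarrow> (\<lambda>x. if x \<in> {-2..0} then g x else 0) \<in> Ecar"
  by (auto simp: Ecar_def elim!: continuous_on_eq)

lemma Ecar_eqI: "f \<in> Ecar \<Longrightarrow> g \<in> Ecar \<Longrightarrow> (\<And>x. x \<in> {-2..0} \<Longrightarrow> f x = g x) \<Longrightarrow> f = g"
  unfolding Ecar_def fun_eq_iff by (metis (mono_tags, lifting) mem_Collect_eq)

lemma Ecar_add: "f \<in> Ecar \<Longrightarrow> g \<in> Ecar \<Longrightarrow> (\<lambda>x. f x + g x) \<in> Ecar"
  and Ecar_diff: "f \<in> Ecar \<Longrightarrow> g \<in> Ecar \<Longrightarrow> (\<lambda>x. f x - g x) \<in> Ecar"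
  and Ecar_mult: "f \<in> Ecar \<Longrightarrow> (\<lambda>x. c * f x) \<in> Ecar"
  and Ecar_divide: "f \<in> Ecar \<Longrightarrow> (\<lambda>x. f x / c) \<in> Ecar"
  by (auto simp: Ecar_def divide_inverse intro!: continuous_intros)

lemma zero_in_Ecar: "(\<lambda>x. 0) \<in> Ecar"
  by (auto simp: Ecar_def)

lemma supn_upper:
  assumes "continuous_on {-2..0} f" "x \<in> {-2..0}"
  shows "cmod (f x) \<le> supn f"
proof -
  have "compact ((\<lambda>x. cmod (f x)) ` {-2..0})"
    using assms by (intro compact_continuous_image continuous_intros) auto
  then have "bdd_above ((\<lambda>x. cmod (f x)) ` {-2..0})"
    by (simp add: bounded_imp_bdd_above compact_imp_bounded)
  then show ?thesis unfolding supn_def using assms(2) by (rule cSUP_upper2) auto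
qed

lemma supn_least: "(\<And>x. x \<in> {-2..0} \<Longrightarrow> cmod (f x) \<le> B) \<Longrightarrow> supn f \<le> B"
  unfolding supn_def by (rule cSUP_least) auto

lemma supn_nonneg: "continuous_on {-2..0} f \<Longrightarrow> 0 \<le> supn f"
  using supn_upper[of f 0] norm_ge_zero[of "f 0"] by (simp add: order_trans[of 0 "cmod (f 0)"] del: norm_ge_zero)

lemma supn_tendsto_zeroI:
  fixes F :: "real \<Rightarrow> real \<Rightarrow> complex"
  assumes "\<And>h. h > 0 \<Longrightarrow> continuous_on {-2..0} (F h)"
    and "\<And>e. e > 0 \<Longrightarrow> \<exists>d>0. \<forall>h. 0 < h \<and> h < d \<longrightarrow> (\<forall>x\<in>{-2..0}. cmod (F h x) \<le> e)"
  shows "((\<lambda>h. supn (F h)) \<longlongrightarrow> 0) (at_right 0)"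
proof (rule tendstoI)
  fix e :: real assume "e > 0"
  then obtain d where d: "d > 0" "\<And>h x. 0 < h \<Longrightarrow> h < d \<Longrightarrow> x \<in> {-2..0} \<Longrightarrow> cmod (F h x) \<le> e / 2"
    using assms(2)[of "e / 2"] by auto
  have "dist (supn (F h)) 0 < e" if "0 < h" "h < d" for h
  proof -
    have "supn (F h) \<le> e / 2" using d that by (intro supn_least) auto
    then show ?thesis using supn_nonneg[OF assms(1)[OF that(1)]] \<open>e > 0\<close> by simp
  qed
  then show "\<forall>\<^sub>F h in at_right 0. dist (supn (F h)) 0 < e"
    unfolding eventually_at_right_field using d(1) by blast
qed

lemma supn_tendsto_zeroD:
  fixes F :: "real \<Rightarrow> real \<Rightarrow> complex"
  assumes "((\<lambda>h. supn (F h)) \<longlongrightarrow> 0) (at_right 0)" "e > 0"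
    and "\<And>h. h > 0 \<Longrightarrow> continuous_on {-2..0} (F h)"
  obtains d where "d > 0" "\<And>h x. 0 < h \<Longrightarrow> h < d \<Longrightarrow> x \<in> {-2..0} \<Longrightarrow> cmod (F h x) < e"
proof -
  have "\<forall>\<^sub>F h in at_right 0. dist (supn (F h)) 0 < e" using assms(1,2) by (rule tendstoD)
  then obtain d where d: "d > 0" "\<And>h. 0 < h \<Longrightarrow> h < d \<Longrightarrow> \<bar>supn (F h)\<bar> < e"
    unfolding eventually_at_right_field dist_real_def diff_0_right by (metis (no_types))
  have "cmod (F h x) < e" if "0 < h" "h < d" "x \<in> {-2..0}" for h x
    using supn_upper[OF assms(3) that(3), of h] d(2)[of h] that by fastforce
  then show ?thesis using that d(1) by blast
qed

definition mass :: "(real \<Rightarrow> complex) \<Rightarrow> complex" where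
  "mass f = f 0 + integral {-2..-1} f"

lemma Ecar_integrable: "f \<in> Ecar \<Longrightarrow> {a..b} \<subseteq> {-2..0} \<Longrightarrow> f integrable_on {a..b}"
  by (meson EcarD(1) continuous_on_subset integrable_continuous_real)

lemma mass_bound:
  assumes "f \<in> Ecar"
  shows "cmod (mass f) \<le> 2 * supn f"
proof -
  have "cmod (integral {-2..-1} f) \<le> supn f * (-1 - (-2))"
    using assms by (intro integral_bound supn_upper) (auto simp: Ecar_def intro: continuous_on_subset)
  moreover have "cmod (f 0) \<le> supn f" using assms by (intro supn_upper) (auto simp: Ecar_def)
  ultimately show ?thesis unfolding mass_def using norm_triangle_ineq[of "f 0" "integral {-2..-1} f"] by simp
qed

primrec picard :: "(real \<Rightarrow> complex) \<Rightarrow> nat \<Rightarrow> real \<Rightarrow> complex" where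
  "picard f 0 = (\<lambda>t. f (max (-2) (min 0 t)))"
| "picard f (Suc n) = (\<lambda>t. if t \<le> 0 then f (max (-2) t)
     else mass f - integral {t - 2..t - 1} (picard f n))"

definition sol :: "(real \<Rightarrow> complex) \<Rightarrow> real \<Rightarrow> complex" where
  "sol f t = picard f (nat \<lceil>t\<rceil>) t"

lemma picard_init: "t \<le> 0 \<Longrightarrow> picard f n t = f (max (-2) t)"
  by (cases n) auto

lemma picard_stable: "t \<le> real n \<Longrightarrow> picard f (Suc n) t = picard f n t"
proof (induction n arbitrary: t)
  case (Suc n)
  have "integral {t - 2..t - 1} (picard f (Suc n)) = integral {t - 2..t - 1} (picard f n)"
    using Suc by (intro integral_cong) auto
  then show ?case by simp
qed (simp add: picard_init)

lemma picard_eq: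
  assumes "t \<le> real n" "n \<le> m"
  shows "picard f m t = picard f n t"
  using assms(2)
proof (induction m rule: dec_induct)
  case (step m)
  then show ?case using picard_stable[of t m f] assms(1) by simp
qed simp

lemma sol_eq_picard: "t \<le> real n \<Longrightarrow> sol f t = picard f n t"
  unfolding sol_def by (rule picard_eq[symmetric]) linarith+

lemma continuous_picard:
  assumes f: "f \<in> Ecar"
  shows "continuous_on UNIV (picard f n)"
proof (induction n)
  case 0
  show ?case
    unfolding picard.simps by (rule continuous_on_compose2[OF EcarD(1)[OF f]]) (auto intro!: continuous_intros)
next
  case (Suc n)
  obtain G where G: "\<And>x. (G has_vector_derivative picard f n x) (at x)"
      "\<And>a b. a \<le> b \<Longrightarrow> integral {a..b} (picard f n) = G b - G a"
    using continuous_antiderivative[OF Suc] by blast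
  have cG: "continuous_on UNIV G"
    using G(1) by (auto simp: continuous_on_eq_continuous_at intro: has_vector_derivative_continuous)
  have "continuous_on ({..0} \<union> {0..}) (\<lambda>t. if t \<le> 0 then f (max (-2) t) else mass f - (G (t - 1) - G (t - 2)))"
  proof (rule continuous_on_If)
    show "continuous_on {..0} (\<lambda>t. f (max (-2) t))"
      by (rule continuous_on_compose2[OF EcarD(1)[OF f]]) (auto intro!: continuous_intros)
    show "continuous_on {0..} (\<lambda>t. mass f - (G (t - 1) - G (t - 2)))"
      by (intro continuous_intros continuous_on_compose2[OF cG]) auto
    fix t :: real assume "t \<in> {0..}" "t \<le> 0"
    then have [simp]: "t = 0" by simp
    have "integral {-2..-1} (picard f n) = integral {-2..-1} f"
      by (intro integral_cong) (simp add: picard_init)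
    then show "f (max (-2) t) = mass f - (G (t - 1) - G (t - 2))"
      using G(2)[of "-2" "-1"] by (simp add: mass_def)
  next
    fix t :: real assume "t \<in> {..0}" "\<not> t \<le> 0"
    then show "f (max (-2) t) = mass f - (G (t - 1) - G (t - 2))" by simp
  qed auto
  moreover have "{..0} \<union> {0..} = (UNIV :: real set)" by auto
  moreover have "picard f (Suc n) = (\<lambda>t. if t \<le> 0 then f (max (-2) t) else mass f - (G (t - 1) - G (t - 2)))"
    by (simp add: G(2) fun_eq_iff)
  ultimately show ?case by metis
qed

lemma sol_init: "x \<in> {-2..0} \<Longrightarrow> sol f x = f x"
  using sol_eq_picard[of x 0 f] by (simp add: picard_init)

lemma renewal_sol:
  assumes f: "f \<in> Ecar"
  shows "renewal (mass f) (sol f)"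
  unfolding renewal_def
proof (intro conjI allI impI)
  have "continuous_on {..<real n} (sol f)" for n
    using continuous_on_subset[OF continuous_picard[OF f, of n]]
    by (rule continuous_on_eq) (auto simp: sol_eq_picard[of _ n])
  then have "continuous_on (\<Union>n. {..<real n}) (sol f)"
    by (intro continuous_on_open_UN) auto
  moreover have "(\<Union>n. {..<real n}) = UNIV"
    using reals_Archimedean2 by auto
  ultimately show "continuous_on UNIV (sol f)" by simp
next
  fix t :: real assume t: "t \<ge> 0"
  show "sol f t = mass f - integral {t - 2..t - 1} (sol f)"
  proof (cases "t = 0")
    case True
    have "integral {-2..-1} (sol f) = integral {-2..-1} f"
      by (intro integral_cong) (simp add: sol_init)
    then show ?thesis using True by (simp add: mass_def sol_init)
  next
    case False
    define n where "n = nat \<lceil>t\<rceil>"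
    have n: "t \<le> real n" unfolding n_def by linarith
    have "sol f t = picard f (Suc n) t" using n by (intro sol_eq_picard) simp
    also have "\<dots> = mass f - integral {t - 2..t - 1} (picard f n)" using t False by simp
    also have "integral {t - 2..t - 1} (picard f n) = integral {t - 2..t - 1} (sol f)"
      using n by (intro integral_cong) (simp add: sol_eq_picard[of _ n])
    finally show ?thesis .
  qed
qed

lemma continuous_sol: "f \<in> Ecar \<Longrightarrow> continuous_on S (sol f)"
  using renewal_sol by (auto simp: renewal_def intro: continuous_on_subset)

lemma renewal_sol_zero:
  assumes "f \<in> Ecar"
  shows "renewal 0 (\<lambda>t. sol f t - mass f / 2)"
  using renewal_linear[OF renewal_sol[OF assms] renewal_const[of "mass f / 2"], of 1 "-1"] by simp

lemma sol_decay:
  assumes f: "f \<in> Ecar" and x: "x \<ge> 5 * real n - 2"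
  shows "cmod (sol f x - mass f / 2) \<le> (127 / 128) ^ n * (2 * supn f)"
proof (rule renewal_zero_decay[OF renewal_sol_zero[OF f] _ x])
  fix x :: real assume x: "x \<in> {-2..0}"
  have "cmod (sol f x - mass f / 2) \<le> cmod (f x) + cmod (mass f / 2)"
    using norm_triangle_ineq4[of "f x" "mass f / 2"] x by (simp add: sol_init)
  also have "\<dots> \<le> supn f + supn f"
    using supn_upper[OF EcarD(1)[OF f] x] mass_bound[OF f] by (simp add: norm_divide)
  finally show "cmod (sol f x - mass f / 2) \<le> 2 * supn f" by simp
qed

lemma sol_bound:
  assumes f: "f \<in> Ecar" and x: "x \<ge> -2"
  shows "cmod (sol f x) \<le> 3 * supn f"
proof -
  have "cmod (sol f x) \<le> cmod (sol f x - mass f / 2) + cmod (mass f / 2)"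
    by (metis diff_add_cancel norm_triangle_ineq)
  also have "\<dots> \<le> 2 * supn f + supn f"
    using sol_decay[OF f, of 0 x] x mass_bound[OF f] by (intro add_mono) (auto simp: norm_divide)
  finally show ?thesis by simp
qed

definition semi :: "real \<Rightarrow> (real \<Rightarrow> complex) \<Rightarrow> real \<Rightarrow> complex" where
  "semi t f x = (if x \<in> {-2..0} then sol f (t + x) else 0)"

lemma semi_in_Ecar:
  assumes "f \<in> Ecar"
  shows "semi t f \<in> Ecar"
  unfolding semi_def
  by (rule Ecar_restrictI, rule continuous_on_compose2[OF continuous_sol[OF assms, of UNIV]])
    (auto intro!: continuous_intros)

lemma bounded_semi:
  assumes t: "t \<ge> 0"
  shows "bounded_opE (semi t)"
  unfolding bounded_opE_def
proof (intro conjI ballI allI)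
  fix f g assume fg: "f \<in> Ecar" "g \<in> Ecar"
  have "sol (\<lambda>x. f x + g x) x = 1 * sol f x + 1 * sol g x" if "x \<ge> -2" for x
    using renewal_sol[OF Ecar_add[OF fg]] renewal_linear[OF renewal_sol[OF fg(1)] renewal_sol[OF fg(2)]] _ that
    by (rule renewal_zero_unique) (simp add: sol_init)
  then show "semi t (\<lambda>x. f x + g x) = (\<lambda>x. semi t f x + semi t g x)"
    using t by (auto simp: semi_def fun_eq_iff)
next
  fix f and c :: complex assume f: "f \<in> Ecar"
  have "sol (\<lambda>x. c * f x) x = c * sol f x + 0 * sol f x" if "x \<ge> -2" for x
    using renewal_sol[OF Ecar_mult[OF f]] renewal_linear[OF renewal_sol[OF f] renewal_sol[OF f]] _ that
    by (rule renewal_zero_unique) (simp add: sol_init)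
  then show "semi t (\<lambda>x. c * f x) = (\<lambda>x. c * semi t f x)"
    using t by (auto simp: semi_def fun_eq_iff)
next
  show "\<exists>M. \<forall>f\<in>Ecar. supn (semi t f) \<le> M * supn f"
    using t by (intro exI[of _ 3] ballI supn_least) (auto simp: semi_def intro!: sol_bound)
qed (rule semi_in_Ecar)

lemma sol_semi:
  assumes "f \<in> Ecar" "t \<ge> 0" "x \<ge> -2"
  shows "sol (semi t f) x = sol f (t + x)"
  using renewal_sol[OF semi_in_Ecar[OF assms(1)]] renewal_shift[OF renewal_sol[OF assms(1)] assms(2)] _ assms(3)
  by (rule renewal_zero_unique) (simp add: sol_init semi_def)

lemma C0_semigroup_semi: "C0_semigroup semi"
  unfolding C0_semigroup_def
proof (intro conjI ballI allI impI)
  fix f assume f: "f \<in> Ecar"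
  show "semi 0 f = f"
    using f by (intro Ecar_eqI semi_in_Ecar) (auto simp: semi_def sol_init)
  fix s t :: real assume "0 \<le> s" "0 \<le> t"
  then show "semi (s + t) f = semi s (semi t f)"
    using f by (auto simp: semi_def[of "s + t"] semi_def[of s "semi t f"] fun_eq_iff sol_semi ac_simps)
next
  fix f assume f: "f \<in> Ecar"
  show "((\<lambda>t. supn (\<lambda>x. semi t f x - f x)) \<longlongrightarrow> 0) (at_right 0)"
  proof (rule supn_tendsto_zeroI)
    show "continuous_on {-2..0} (\<lambda>x. semi h f x - f x)" for h
      using f by (intro EcarD(1) Ecar_diff semi_in_Ecar)
    fix e :: real assume e: "e > 0"
    have "uniformly_continuous_on {-2..1} (sol f)"
      using f by (intro compact_uniformly_continuous continuous_sol) auto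
    then obtain d where d: "d > 0"
      "\<And>x y. x \<in> {-2..1} \<Longrightarrow> y \<in> {-2..1} \<Longrightarrow> dist y x < d \<Longrightarrow> dist (sol f y) (sol f x) < e"
      using e unfolding uniformly_continuous_on_def by metis
    have "cmod (semi h f x - f x) \<le> e" if "0 < h" "h < min d 1" "x \<in> {-2..0}" for h x
      using d(2)[of x "h + x"] that by (auto simp: semi_def dist_norm sol_init)
    then show "\<exists>d>0. \<forall>h. 0 < h \<and> h < d \<longrightarrow> (\<forall>x\<in>{-2..0}. cmod (semi h f x - f x) \<le> e)"
      using d(1) by (intro exI[of _ "min d 1"]) auto
  qed
qed (rule bounded_semi)

subsection \<open>The generator\<close>

lemma DA_derivative:
  assumes "f \<in> DA"
  shows "opA f \<in> Ecar"
    and "x \<in> {-2..0} \<Longrightarrow> (f has_vector_derivative opA f x) (at x within {-2..0})"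
    and "opA f 0 = f (-2) - f (-1)"
proof -
  show "opA f \<in> Ecar"
    unfolding opA_def using assms by (intro Ecar_restrictI) (simp add: DA_def)
  show "x \<in> {-2..0} \<Longrightarrow> (f has_vector_derivative opA f x) (at x within {-2..0})"
    using assms vector_derivative_works[of f "at x within {-2..0}"] by (auto simp: DA_def opA_def)
  show "opA f 0 = f (-2) - f (-1)"
    using assms by (simp add: DA_def opA_def)
qed

lemma DA_subset: "DA \<subseteq> Ecar"
  by (auto simp: DA_def)

lemma DA_I:
  assumes f: "f \<in> Ecar" and g: "g \<in> Ecar"
    and d: "\<And>x. x \<in> {-2..0} \<Longrightarrow> (f has_vector_derivative g x) (at x within {-2..0})"
    and b: "g 0 = f (-2) - f (-1)"
  shows "f \<in> DA" "opA f = g"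
proof -
  have v: "vector_derivative f (at x within {-2..0}) = g x" if "x \<in> {-2..0}" for x
    using d[OF that] that by (intro vector_derivative_within_cbox[of "-2" 0, simplified]) auto
  have "continuous_on {-2..0} (\<lambda>x. vector_derivative f (at x within {-2..0}))"
    using EcarD(1)[OF g] by (rule continuous_on_eq) (simp add: v)
  then show "f \<in> DA"
    using f v b differentiableI_vector[OF d] by (simp add: DA_def)
  show "opA f = g" using g by (auto simp: opA_def v Ecar_def fun_eq_iff)
qed

lemma quotient_in_Ecar:
  assumes "u \<in> Ecar" "f \<in> Ecar" "g \<in> Ecar"
  shows "(\<lambda>x. (u x - f x) / c - g x) \<in> Ecar"
  by (intro Ecar_diff Ecar_divide assms)

lemma semi_quotient_tendsto:
  assumes f: "f \<in> DA"
  shows "((\<lambda>h. supn (\<lambda>x. (semi h f x - f x) / complex_of_real h - opA f x)) \<longlongrightarrow> 0) (at_right 0)"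
proof (rule supn_tendsto_zeroI)
  have fE: "f \<in> Ecar" using f by (simp add: DA_def)
  note gE = DA_derivative(1)[OF f]
  show "continuous_on {-2..0} (\<lambda>x. (semi h f x - f x) / complex_of_real h - opA f x)" for h
    by (intro EcarD(1) quotient_in_Ecar semi_in_Ecar fE gE)
  fix e :: real assume e: "e > 0"
  define p where "p t = (if t \<le> 0 then opA f (max (-2) t) else sol f (t - 2) - sol f (t - 1))" for t
  have "continuous_on ({..0} \<union> {0..}) p"
    unfolding p_def
  proof (rule continuous_on_If)
    show "continuous_on {..0} (\<lambda>t. opA f (max (-2) t))"
      by (rule continuous_on_compose2[OF EcarD(1)[OF gE]]) (auto intro!: continuous_intros)
    show "continuous_on {0..} (\<lambda>t. sol f (t - 2) - sol f (t - 1))"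
      by (intro continuous_intros continuous_on_compose2[OF continuous_sol[OF fE, of UNIV]]) auto
    fix t :: real assume "t \<in> {0..}" "t \<le> 0"
    then have "t = 0" by simp
    then show "opA f (max (-2) t) = sol f (t - 2) - sol f (t - 1)"
      using DA_derivative(3)[OF f] by (simp add: sol_init)
  qed auto
  moreover have "{..0} \<union> {0..} = (UNIV :: real set)" by auto
  ultimately have cp: "continuous_on UNIV p" by simp
  then obtain G where G: "\<And>x. (G has_vector_derivative p x) (at x)"
    using continuous_antiderivative by blast
  have "((\<lambda>t. sol f t - G t) has_vector_derivative p t - p t) (at t within {-2..0})" if "t \<in> {-2..0}" for t
  proof (intro derivative_intros has_vector_derivative_at_within[OF G])
    have "(f has_vector_derivative p t) (at t within {-2..0})"
      using DA_derivative(2)[OF f that] that by (simp add: p_def)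
    then show "(sol f has_vector_derivative p t) (at t within {-2..0})"
      by (rule has_vector_derivative_transform[rotated 2]) (use that in \<open>auto simp: sol_init\<close>)
  qed
  then obtain c where c: "\<And>t. t \<in> {-2..0} \<Longrightarrow> sol f t - G t = c"
    using has_vector_derivative_zero_constant[of "{-2..0}" "\<lambda>t. sol f t - G t"]
    by (metis convex_real_interval(5) diff_self)
  have p0: "p t = sol f (t - 2) - sol f (t - 1)" if "t \<ge> 0" for t
    using that DA_derivative(3)[OF f] by (cases "t = 0") (auto simp: p_def sol_init)
  have "((\<lambda>t. sol f t - G t) has_vector_derivative p t - p t) (at t within {0..})" if "t \<in> {0..}" for t
    using renewal_has_vector_derivative[OF renewal_sol[OF fE], of t] that p0[of t]
    by (intro derivative_intros has_vector_derivative_at_within[OF G]) auto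
  then obtain c' where c': "\<And>t. t \<in> {0..} \<Longrightarrow> sol f t - G t = c'"
    using has_vector_derivative_zero_constant[of "{0..}" "\<lambda>t. sol f t - G t"]
    by (metis convex_real_interval(1) diff_self)
  have "c = c'" using c[of 0] c'[of 0] by simp
  then have solG: "sol f t = G t + c" if "t \<ge> -2" for t
    using that c[of t] c'[of t] by (cases "t \<le> 0") (auto simp: algebra_simps)
  obtain d where d: "d > 0" "\<And>h x. 0 < h \<Longrightarrow> h < d \<Longrightarrow> x \<in> {-2..0} \<Longrightarrow>
      cmod ((G (x + h) - G x) / of_real h - p x) \<le> e"
    using uniform_difference_quotient[OF G cp e] by blast
  have "cmod ((semi h f x - f x) / of_real h - opA f x) \<le> e" if h: "0 < h" "h < d" "x \<in> {-2..0}" for h x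
  proof -
    have "semi h f x - f x = G (x + h) - G x"
      using h sol_init[of x f, symmetric] by (simp add: semi_def add.commute[of h] solG)
    moreover have "p x = opA f x" using h by (simp add: p_def)
    ultimately show ?thesis using d(2)[OF h] by simp
  qed
  then show "\<exists>d>0. \<forall>h. 0 < h \<and> h < d \<longrightarrow>
      (\<forall>x\<in>{-2..0}. cmod ((semi h f x - f x) / complex_of_real h - opA f x) \<le> e)"
    using d(1) by blast
qed

lemma semi_quotient_limit:
  assumes f: "f \<in> Ecar" and g: "g \<in> Ecar"
    and lim: "((\<lambda>h. supn (\<lambda>x. (semi h f x - f x) / complex_of_real h - g x)) \<longlongrightarrow> 0) (at_right 0)"
  shows "f \<in> DA"
proof -
  have q: "\<exists>d>0. \<forall>h x. 0 < h \<longrightarrow> h < d \<longrightarrow> x \<in> {-2..0} \<longrightarrow>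
      cmod (sol f (x + h) - sol f x - of_real h * g x) \<le> e * h" if e: "e > 0" for e
  proof -
    obtain d where d: "d > 0" "\<And>h x. 0 < h \<Longrightarrow> h < d \<Longrightarrow> x \<in> {-2..0} \<Longrightarrow>
        cmod ((semi h f x - f x) / of_real h - g x) < e"
      using supn_tendsto_zeroD[OF lim e EcarD(1)] quotient_in_Ecar[OF semi_in_Ecar[OF f] f g] by blast
    have "cmod (sol f (x + h) - sol f x - of_real h * g x) \<le> e * h" if h: "0 < h" "h < d" "x \<in> {-2..0}" for h x
    proof -
      have "sol f (x + h) - sol f x - of_real h * g x = of_real h * ((semi h f x - f x) / of_real h - g x)"
        using h by (simp add: semi_def sol_init field_simps)
      also have "cmod \<dots> \<le> h * e"
        using d(2)[OF h] h by (simp add: norm_mult)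
      finally show ?thesis by (simp add: mult.commute)
    qed
    then show ?thesis using d(1) by blast
  qed
  show ?thesis
  proof (rule DA_I(1)[OF f g])
    have "(sol f has_vector_derivative g 0) (at 0 within {0..})"
      unfolding has_vector_derivative_def has_derivative_within_alt
    proof (intro conjI allI impI bounded_linear_scaleR_left)
      fix e :: real assume "e > 0"
      then obtain d where d: "d > 0" "\<And>h x. 0 < h \<Longrightarrow> h < d \<Longrightarrow> x \<in> {-2..0} \<Longrightarrow>
          cmod (sol f (x + h) - sol f x - of_real h * g x) \<le> e * h"
        using q by blast
      have "cmod (sol f y - sol f 0 - (y - 0) *\<^sub>R g 0) \<le> e * norm (y - 0)" if "y \<ge> 0" "y < d" for y
        using d(2)[of y 0] that by (cases "y = 0") (auto simp: scaleR_conv_of_real)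
      then show "\<exists>d>0. \<forall>y\<in>{0..}. norm (y - 0) < d \<longrightarrow>
          norm (sol f y - sol f 0 - (y - 0) *\<^sub>R g 0) \<le> e * norm (y - 0)"
        using d(1) by (intro exI[of _ d]) auto
    qed
    moreover have "(sol f has_vector_derivative sol f (0 - 2) - sol f (0 - 1)) (at 0 within {0..})"
      by (rule renewal_has_vector_derivative[OF renewal_sol[OF f]]) simp
    ultimately have "g 0 = sol f (0 - 2) - sol f (0 - 1)"
      by (rule vector_derivative_unique_within[rotated]) (simp add: at_within_Ici_at_right)
    then show "g 0 = f (-2) - f (-1)" by (simp add: sol_init)
  next
    fix x :: real assume x: "x \<in> {-2..0}"
    show "(f has_vector_derivative g x) (at x within {-2..0})"
      unfolding has_vector_derivative_def has_derivative_within_alt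
    proof (intro conjI allI impI bounded_linear_scaleR_left)
      fix e :: real assume e: "e > 0"
      then obtain d where d: "d > 0" "\<And>h x. 0 < h \<Longrightarrow> h < d \<Longrightarrow> x \<in> {-2..0} \<Longrightarrow>
          cmod (sol f (x + h) - sol f x - of_real h * g x) \<le> e / 2 * h"
        using q[of "e / 2"] by (metis half_gt_zero)
      obtain d' where d': "d' > 0" "\<And>y. y \<in> {-2..0} \<Longrightarrow> \<bar>y - x\<bar> < d' \<Longrightarrow> cmod (g y - g x) < e / 2"
        using EcarD(1)[OF g] x e unfolding continuous_on_iff dist_norm real_norm_def
        by (metis half_gt_zero)
      have "cmod (f y - f x - (y - x) *\<^sub>R g x) \<le> e * norm (y - x)"
        if y: "y \<in> {-2..0}" "\<bar>y - x\<bar> < min d d'" for y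
      proof -
        consider "y = x" | "y > x" | "y < x" by linarith
        then show ?thesis
        proof cases
          case 2
          then have "cmod (f y - f x - (y - x) *\<^sub>R g x) \<le> e / 2 * (y - x)"
            using d(2)[of "y - x" x] x y by (simp add: sol_init scaleR_conv_of_real)
          also have "\<dots> \<le> e * (y - x)" using e 2 by (intro mult_right_mono) auto
          finally show ?thesis using 2 by simp
        next
          case 3
          have "f y - f x - (y - x) *\<^sub>R g x =
              - (f x - f y - of_real (x - y) * g y) - of_real (x - y) * (g y - g x)"
            by (simp add: scaleR_conv_of_real algebra_simps)
          also have "cmod \<dots> \<le> cmod (f x - f y - of_real (x - y) * g y) + cmod (of_real (x - y) * (g y - g x))"
            by (metis norm_minus_cancel norm_triangle_ineq4)
          also have "cmod (f x - f y - of_real (x - y) * g y) \<le> e / 2 * (x - y)"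
            using d(2)[of "x - y" y] x y 3 by (simp add: sol_init)
          also have "cmod (of_real (x - y) * (g y - g x)) \<le> (x - y) * (e / 2)"
            using d'(2)[of y] y 3 unfolding norm_mult norm_of_real by (intro mult_mono) auto
          finally show ?thesis using 3 by (simp add: algebra_simps)
        qed auto
      qed
      then show "\<exists>d>0. \<forall>y\<in>{-2..0}. norm (y - x) < d \<longrightarrow>
          norm (f y - f x - (y - x) *\<^sub>R g x) \<le> e * norm (y - x)"
        using d(1) d'(1) by (intro exI[of _ "min d d'"]) auto
    qed
  qed
qed

lemma is_generator_semi: "is_generator semi DA opA"
  unfolding is_generator_def
proof (intro conjI ballI)
  show "DA = {f \<in> Ecar. \<exists>g\<in>Ecar.
      ((\<lambda>h. supn (\<lambda>x. (semi h f x - f x) / complex_of_real h - g x)) \<longlongrightarrow> 0) (at_right 0)}"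
    using semi_quotient_limit semi_quotient_tendsto DA_derivative(1) DA_subset by blast
qed (use DA_derivative(1) semi_quotient_tendsto in auto)

text \<open>Averaging the solution over \<open>[x, x + h]\<close> yields elements of the domain.\<close>
lemma DA_dense:
  assumes f: "f \<in> Ecar" and e: "e > 0"
  shows "\<exists>g\<in>DA. supn (\<lambda>x. f x - g x) \<le> e"
proof -
  have c: "continuous_on UNIV (sol f)" by (rule continuous_sol[OF f])
  obtain G where G: "\<And>x. (G has_vector_derivative sol f x) (at x)"
      "\<And>a b. a \<le> b \<Longrightarrow> integral {a..b} (sol f) = G b - G a"
    using continuous_antiderivative[OF c] by blast
  obtain d where d: "d > 0" "\<And>h x. 0 < h \<Longrightarrow> h < d \<Longrightarrow> x \<in> {-2..0} \<Longrightarrow>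
      cmod ((G (x + h) - G x) / of_real h - sol f x) \<le> e"
    using uniform_difference_quotient[OF G(1) c e] by blast
  define h where "h = d / 2"
  have h: "0 < h" "h < d" using d by (auto simp: h_def)
  define g where "g x = (if x \<in> {-2..0} then (G (x + h) - G x) / of_real h else 0)" for x
  define g' where "g' x = (if x \<in> {-2..0} then (sol f (x + h) - sol f x) / of_real h else 0)" for x
  have cG: "continuous_on UNIV G"
    using G(1) by (auto simp: continuous_on_eq_continuous_at intro: has_vector_derivative_continuous)
  have gE: "g \<in> Ecar" unfolding g_def
    by (intro Ecar_restrictI continuous_intros continuous_on_compose2[OF cG]) (use h in auto)
  have g'E: "g' \<in> Ecar" unfolding g'_def
    by (intro Ecar_restrictI continuous_intros continuous_on_compose2[OF c]) (use h in auto)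
  have "g \<in> DA"
  proof (rule DA_I(1)[OF gE g'E])
    fix x :: real assume x: "x \<in> {-2..0}"
    have "((\<lambda>x. x + h) has_vector_derivative 1) (at x)" by (auto intro!: derivative_eq_intros)
    from vector_diff_chain_at[OF this G(1)]
    have "((\<lambda>x. G (x + h) - G x) has_vector_derivative sol f (x + h) - sol f x) (at x within {-2..0})"
      by (intro derivative_intros has_vector_derivative_at_within[OF G(1)])
        (simp add: o_def has_vector_derivative_at_within)
    then have "((\<lambda>x. (G (x + h) - G x) / of_real h) has_vector_derivative g' x) (at x within {-2..0})"
      using x by (auto simp: g'_def intro: has_vector_derivative_divide)
    then show "(g has_vector_derivative g' x) (at x within {-2..0})"
      by (rule has_vector_derivative_transform[rotated 2]) (use x in \<open>auto simp: g_def\<close>)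
  next
    have K: "sol f t = mass f - (G (t - 1) - G (t - 2))" if "t \<ge> 0" for t
      using renewal_sol[OF f] that by (simp add: renewal_def G(2))
    show "g' 0 = g (-2) - g (-1)"
      using h by (simp add: g_def g'_def diff_divide_distrib[symmetric] K algebra_simps)
  qed
  moreover have "supn (\<lambda>x. f x - g x) \<le> e"
    using d(2)[OF h] by (intro supn_least) (simp add: g_def sol_init norm_minus_commute)
  ultimately show ?thesis by blast
qed

subsection \<open>Transfer to bounded continuous functions\<close>

instance bcontfun :: (metric_space, banach) banach ..

definition emb :: "(real \<Rightarrow> complex) \<Rightarrow> real \<Rightarrow>\<^sub>C complex" where
  "emb f = Bcontfun (\<lambda>x. f (max (-2) (min 0 x)))"

definition res :: "(real \<Rightarrow>\<^sub>C complex) \<Rightarrow> real \<Rightarrow> complex" where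
  "res \<phi> x = (if x \<in> {-2..0} then apply_bcontfun \<phi> x else 0)"

lemma apply_emb:
  assumes f: "f \<in> Ecar"
  shows "apply_bcontfun (emb f) = (\<lambda>x. f (max (-2) (min 0 x)))"
proof -
  have "continuous_on UNIV (\<lambda>x. f (max (-2) (min 0 x)))"
    by (rule continuous_on_compose2[OF EcarD(1)[OF f]]) (auto intro!: continuous_intros)
  then have "(\<lambda>x. f (max (-2) (min 0 x))) \<in> bcontfun"
    by (rule bcontfun_normI[of _ "supn f"]) (rule supn_upper[OF EcarD(1)[OF f]], auto)
  then show ?thesis unfolding emb_def by (rule Bcontfun_inverse)
qed

lemma norm_emb: "f \<in> Ecar \<Longrightarrow> norm (emb f) = supn f"
proof (rule antisym)
  assume f: "f \<in> Ecar"
  show "norm (emb f) \<le> supn f"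
    by (rule norm_bound) (use f in \<open>auto simp: apply_emb intro!: supn_upper EcarD(1)\<close>)
  show "supn f \<le> norm (emb f)"
  proof (rule supn_least)
    fix x :: real assume "x \<in> {-2..0}"
    then show "cmod (f x) \<le> norm (emb f)"
      using norm_bounded[of "emb f" x] f by (simp add: apply_emb max_def min_def split: if_splits)
  qed
qed

lemma res_in_Ecar: "res \<phi> \<in> Ecar"
  unfolding res_def by (intro Ecar_restrictI continuous_on_apply_bcontfun)

lemma supn_res: "supn (res \<phi>) \<le> norm \<phi>"
  by (rule supn_least) (simp add: res_def norm_bounded)

lemma res_emb: "f \<in> Ecar \<Longrightarrow> res (emb f) = f"
  by (auto simp: res_def apply_emb fun_eq_iff EcarD(2) max_def min_def)

lemma res_diff: "res (\<phi> - \<psi>) = (\<lambda>x. res \<phi> x - res \<psi> x)"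
  and res_add: "res (\<phi> + \<psi>) = (\<lambda>x. res \<phi> x + res \<psi> x)"
  and res_scaleR: "res (r *\<^sub>R \<phi>) = (\<lambda>x. of_real r * res \<phi> x)"
  by (auto simp: res_def fun_eq_iff scaleR_conv_of_real)

lemma emb_diff: "f \<in> Ecar \<Longrightarrow> g \<in> Ecar \<Longrightarrow> emb (\<lambda>x. f x - g x) = emb f - emb g"
  and emb_add: "f \<in> Ecar \<Longrightarrow> g \<in> Ecar \<Longrightarrow> emb (\<lambda>x. f x + g x) = emb f + emb g"
  and emb_scaleR: "f \<in> Ecar \<Longrightarrow> emb (\<lambda>x. of_real r * f x) = r *\<^sub>R emb f"
  by (auto intro!: bcontfun_eqI simp: apply_emb Ecar_diff Ecar_add Ecar_mult scaleR_conv_of_real)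

definition lift_op :: "((real \<Rightarrow> complex) \<Rightarrow> real \<Rightarrow> complex) \<Rightarrow> (real \<Rightarrow>\<^sub>C complex) \<Rightarrow> real \<Rightarrow>\<^sub>C complex" where
  "lift_op S \<phi> = emb (S (res \<phi>))"

lemma bounded_linear_lift_op:
  assumes "bounded_opE S"
  shows "bounded_linear (lift_op S)"
proof -
  have S: "S f \<in> Ecar" if "f \<in> Ecar" for f using assms that by (simp add: bounded_opE_def)
  obtain M where M: "\<And>f. f \<in> Ecar \<Longrightarrow> supn (S f) \<le> M * supn f"
    using assms unfolding bounded_opE_def by blast
  show ?thesis
  proof (rule bounded_linear_intro)
    fix \<phi> \<psi> :: "real \<Rightarrow>\<^sub>C complex" and r :: real
    show "lift_op S (\<phi> + \<psi>) = lift_op S \<phi> + lift_op S \<psi>"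
      using assms by (simp add: lift_op_def res_add bounded_opE_def res_in_Ecar emb_add)
    show "lift_op S (r *\<^sub>R \<phi>) = r *\<^sub>R lift_op S \<phi>"
      using assms by (simp add: lift_op_def res_scaleR bounded_opE_def res_in_Ecar emb_scaleR)
    have "norm (lift_op S \<phi>) = supn (S (res \<phi>))"
      by (simp add: lift_op_def norm_emb S res_in_Ecar)
    also have "\<dots> \<le> M * supn (res \<phi>)" by (intro M res_in_Ecar)
    also have "\<dots> \<le> \<bar>M\<bar> * supn (res \<phi>)"
      using supn_nonneg[OF EcarD(1)[OF res_in_Ecar]] by (intro mult_right_mono) auto
    also have "\<dots> \<le> \<bar>M\<bar> * norm \<phi>" by (intro mult_left_mono supn_res) auto
    finally show "norm (lift_op S \<phi>) \<le> norm \<phi> * \<bar>M\<bar>" by (simp add: mult.commute)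
  qed
qed

lemma degenerate_semigroup_lift:
  assumes T: "C0_semigroup T"
  shows "degenerate_semigroup (\<lambda>t. lift_op (T t))"
proof (rule degenerate_semigroup.intro)
  show "bounded_linear (lift_op (T t))" if "t \<ge> 0" for t
    using T that by (simp add: C0_semigroup_def bounded_linear_lift_op)
next
  have TE: "T t f \<in> Ecar" if "t \<ge> 0" "f \<in> Ecar" for t f
    using T that by (simp add: C0_semigroup_def bounded_opE_def)
  fix s t :: real and \<phi> :: "real \<Rightarrow>\<^sub>C complex" assume "s \<ge> 0" and t: "t \<ge> 0"
  then show "lift_op (T (s + t)) \<phi> = lift_op (T s) (lift_op (T t) \<phi>)"
    using T t by (simp add: C0_semigroup_def lift_op_def res_emb TE res_in_Ecar)
next
  fix \<phi> :: "real \<Rightarrow>\<^sub>C complex"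
  have TE: "T t f \<in> Ecar" if "t \<ge> 0" "f \<in> Ecar" for t f
    using T that by (simp add: C0_semigroup_def bounded_opE_def)
  have "((\<lambda>t. supn (\<lambda>x. T t (res \<phi>) x - res \<phi> x)) \<longlongrightarrow> 0) (at_right 0)"
    using T res_in_Ecar by (simp add: C0_semigroup_def)
  moreover have "\<forall>\<^sub>F t in at_right 0. supn (\<lambda>x. T t (res \<phi>) x - res \<phi> x)
      = norm (lift_op (T t) \<phi> - lift_op (T 0) \<phi>)"
    using eventually_at_right_less
  proof eventually_elim
    case (elim t)
    have "T 0 (res \<phi>) = res \<phi>" using T res_in_Ecar by (simp add: C0_semigroup_def)
    then show ?case
      using elim by (simp add: lift_op_def emb_diff[symmetric] norm_emb TE res_in_Ecar Ecar_diff)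
  qed
  ultimately have "((\<lambda>t. norm (lift_op (T t) \<phi> - lift_op (T 0) \<phi>)) \<longlongrightarrow> 0) (at_right 0)"
    by (rule Lim_transform_eventually)
  then show "((\<lambda>t. lift_op (T t) \<phi>) \<longlongrightarrow> lift_op (T 0) \<phi>) (at_right 0)"
    by (rule LIM_zero_cancel[OF tendsto_norm_zero_cancel])
qed

lemma gen_lift_iff:
  assumes T: "C0_semigroup T" and g: "is_generator T DA opA"
  shows "degenerate_semigroup.gen (\<lambda>t. lift_op (T t)) \<phi> \<psi> \<longleftrightarrow> res \<phi> \<in> DA \<and> \<psi> = emb (opA (res \<phi>))"
proof -
  interpret degenerate_semigroup "\<lambda>t. lift_op (T t)" using T by (rule degenerate_semigroup_lift)
  have TE: "T t f \<in> Ecar" if "t \<ge> 0" "f \<in> Ecar" for t f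
    using T that by (simp add: C0_semigroup_def bounded_opE_def)
  define f where "f = res \<phi>"
  have f: "f \<in> Ecar" by (simp add: f_def res_in_Ecar)
  have T0: "T 0 f = f" using T f by (simp add: C0_semigroup_def)
  define q where "q h = (\<lambda>x. (T h f x - f x) / complex_of_real h)" for h
  have qE: "q h \<in> Ecar" if "h > 0" for h
    unfolding q_def using that f by (intro Ecar_divide Ecar_diff TE) auto
  have embq: "(lift_op (T h) \<phi> - lift_op (T 0) \<phi>) /\<^sub>R h = emb (q h)" if h: "h > 0" for h
  proof -
    have "q h = (\<lambda>x. of_real (inverse h) * (T h f x - f x))"
      by (simp add: q_def divide_inverse mult.commute)
    then show ?thesis
      using h f TE[of h f] Ecar_diff[of "T h f" f]
      by (simp only: lift_op_def f_def[symmetric] T0 emb_scaleR emb_diff less_imp_le)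
  qed
  have lim: "((\<lambda>h. supn (\<lambda>x. q h x - opA f x)) \<longlongrightarrow> 0) (at_right 0)" if "f \<in> DA"
    using g that by (simp add: is_generator_def q_def)
  have gen_DA: "gen \<phi> (emb (opA f))" if fD: "f \<in> DA"
  proof -
    have "\<forall>\<^sub>F h in at_right 0. supn (\<lambda>x. q h x - opA f x)
        = norm ((lift_op (T h) \<phi> - lift_op (T 0) \<phi>) /\<^sub>R h - emb (opA f))"
      using eventually_at_right_less
      by eventually_elim (simp only: embq emb_diff[symmetric] norm_emb qE DA_derivative(1)[OF fD] Ecar_diff)
    with lim[OF fD] have "((\<lambda>h. norm ((lift_op (T h) \<phi> - lift_op (T 0) \<phi>) /\<^sub>R h - emb (opA f))) \<longlongrightarrow> 0) (at_right 0)"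
      by (rule Lim_transform_eventually)
    then show ?thesis
      unfolding gen_def by (rule LIM_zero_cancel[OF tendsto_norm_zero_cancel])
  qed
  have D_gen: "f \<in> DA" if "gen \<phi> \<psi>"
  proof -
    have "((\<lambda>h. norm ((lift_op (T h) \<phi> - lift_op (T 0) \<phi>) /\<^sub>R h - \<psi>)) \<longlongrightarrow> 0) (at_right 0)"
      using that unfolding gen_def by (rule tendsto_norm_zero[OF LIM_zero])
    then have "((\<lambda>h. supn (\<lambda>x. q h x - res \<psi> x)) \<longlongrightarrow> 0) (at_right 0)"
    proof (rule real_tendsto_sandwich[OF _ _ tendsto_const, rotated 2])
      show "\<forall>\<^sub>F h in at_right 0. 0 \<le> supn (\<lambda>x. q h x - res \<psi> x)"
        using eventually_at_right_less
        by eventually_elim (intro supn_nonneg EcarD(1) Ecar_diff qE res_in_Ecar)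
      show "\<forall>\<^sub>F h in at_right 0. supn (\<lambda>x. q h x - res \<psi> x)
          \<le> norm ((lift_op (T h) \<phi> - lift_op (T 0) \<phi>) /\<^sub>R h - \<psi>)"
        using eventually_at_right_less
      proof eventually_elim
        case (elim h)
        have "(\<lambda>x. q h x - res \<psi> x) = res (emb (q h) - \<psi>)"
          using qE[OF elim] by (simp add: res_diff res_emb)
        then show ?case using supn_res[of "emb (q h) - \<psi>"] embq[OF elim] by simp
      qed
    qed
    then show ?thesis
      using g f res_in_Ecar[of \<psi>] unfolding is_generator_def q_def by blast
  qed
  show ?thesis
  proof
    assume *: "gen \<phi> \<psi>"
    then have "gen \<phi> (emb (opA f))" using D_gen gen_DA by blast
    then have "\<psi> = emb (opA f)"
      using * unfolding gen_def by (intro tendsto_unique) (auto simp: trivial_limit_at_right_real)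
    then show "res \<phi> \<in> DA \<and> \<psi> = emb (opA (res \<phi>))" using D_gen[OF *] by (simp add: f_def)
  next
    assume "res \<phi> \<in> DA \<and> \<psi> = emb (opA (res \<phi>))"
    then show "gen \<phi> \<psi>" using gen_DA by (simp add: f_def)
  qed
qed

lemma semigroup_unique:
  assumes T: "C0_semigroup T" and g: "is_generator T DA opA" and f: "f \<in> Ecar" and t: "t \<ge> 0"
  shows "T t f = semi t f"
proof -
  note gT = gen_lift_iff[OF T g] and gS = gen_lift_iff[OF C0_semigroup_semi is_generator_semi]
  have "emb f \<in> closure {\<phi>. \<exists>\<psi>. degenerate_semigroup.gen (\<lambda>t. lift_op (T t)) \<phi> \<psi>}"
    unfolding closure_approachable
  proof (intro allI impI)
    fix e :: real assume "e > 0"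
    then obtain k where k: "k \<in> DA" "supn (\<lambda>x. f x - k x) \<le> e / 2"
      using DA_dense[OF f, of "e / 2"] by auto
    have kE: "k \<in> Ecar" using k DA_subset by auto
    have "dist (emb k) (emb f) \<le> e / 2"
      using k(2) f kE by (subst dist_commute) (simp add: dist_norm emb_diff[symmetric] norm_emb Ecar_diff)
    then show "\<exists>\<phi>\<in>{\<phi>. \<exists>\<psi>. degenerate_semigroup.gen (\<lambda>t. lift_op (T t)) \<phi> \<psi>}. dist \<phi> (emb f) < e"
      using k(1) kE \<open>e > 0\<close> by (intro bexI[of _ "emb k"]) (auto simp: gT res_emb)
  qed
  moreover have "lift_op (semi 0) \<phi> = lift_op (T 0) \<phi>" for \<phi>
    using T C0_semigroup_semi res_in_Ecar by (simp add: C0_semigroup_def lift_op_def)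
  ultimately have "lift_op (semi t) (emb f) = lift_op (T t) (emb f)"
    using degenerate_semigroup_unique[OF degenerate_semigroup_lift[OF C0_semigroup_semi]
        degenerate_semigroup_lift[OF T] _ _ _ t] gT gS by blast
  then have "emb (semi t f) = emb (T t f)" using f by (simp add: lift_op_def res_emb)
  moreover have "T t f \<in> Ecar" using T f t by (simp add: C0_semigroup_def bounded_opE_def)
  ultimately show ?thesis using semi_in_Ecar[OF f] res_emb by metis
qed

subsection \<open>Asymptotic positivity\<close>

lemma integral_of_real_complex:
  fixes g :: "real \<Rightarrow> real"
  assumes "continuous_on {a..b} g"
  shows "integral {a..b} (\<lambda>x. complex_of_real (g x)) = of_real (integral {a..b} g)"
  using integral_linear[OF integrable_continuous_real[OF assms] bounded_linear_of_real[where 'a = complex]]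
  by (simp add: o_def)

lemma integral_nonneg_complex:
  fixes v :: "real \<Rightarrow> complex"
  assumes v: "continuous_on {a..b} v" "\<And>s. s \<in> {a..b} \<Longrightarrow> Im (v s) = 0 \<and> 0 \<le> Re (v s)"
  shows "Im (integral {a..b} v) = 0 \<and> 0 \<le> Re (integral {a..b} v)"
proof -
  have "integral {a..b} v = integral {a..b} (\<lambda>s. complex_of_real (Re (v s)))"
    using v(2) by (intro integral_cong) (simp add: complex_eq_iff)
  also have "\<dots> = of_real (integral {a..b} (\<lambda>s. Re (v s)))"
    using v(1) by (intro integral_of_real_complex continuous_intros)
  finally show ?thesis
    using v by (auto intro!: integral_nonneg integrable_continuous_real continuous_intros)
qed

lemma mass_nonneg:
  assumes "f \<in> Eplus"
  shows "Im (mass f) = 0 \<and> 0 \<le> Re (mass f)"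
proof -
  have f: "continuous_on {-2..-1} f" "\<And>s. s \<in> {-2..0} \<Longrightarrow> Im (f s) = 0 \<and> 0 \<le> Re (f s)"
    using assms by (auto simp: Eplus_def nonneg_def Ecar_def intro: continuous_on_subset)
  then have "Im (integral {-2..-1} f) = 0 \<and> 0 \<le> Re (integral {-2..-1} f)"
    by (intro integral_nonneg_complex) auto
  then show ?thesis using f(2)[of 0] by (auto simp: mass_def)
qed

definition const_fun :: "complex \<Rightarrow> real \<Rightarrow> complex" where
  "const_fun c x = (if x \<in> {-2..0} then c else 0)"

lemma const_fun_in_Ecar: "const_fun c \<in> Ecar"
  unfolding const_fun_def by (intro Ecar_restrictI continuous_intros)

lemma dplus_le:
  assumes "f \<in> Ecar" "g \<in> Eplus"
  shows "dplus f \<le> supn (\<lambda>x. f x - g x)"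
  unfolding dplus_def
proof (rule cINF_lower[OF _ assms(2)])
  show "bdd_below ((\<lambda>g. supn (\<lambda>x. f x - g x)) ` Eplus)"
    using assms(1) by (intro bdd_belowI2[of _ 0] supn_nonneg EcarD(1) Ecar_diff) (auto simp: Eplus_def)
qed

lemma unif_asym_positive_zero_iff: "unif_asym_positive T 0 \<longleftrightarrow>
    (\<exists>M. \<forall>t\<ge>0. \<forall>f\<in>Ecar. supn (T t f) \<le> M * supn f) \<and>
    (\<forall>\<epsilon>>0. \<exists>t0. \<forall>t\<ge>t0. \<forall>f\<in>Eplus. dplus (T t f) \<le> \<epsilon> * supn f)"
  by (simp add: unif_asym_positive_def)

lemma unif_asym_positive_semi: "unif_asym_positive semi 0"
  unfolding unif_asym_positive_zero_iff
proof (intro conjI allI impI)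
  show "\<exists>M. \<forall>t\<ge>0. \<forall>f\<in>Ecar. supn (semi t f) \<le> M * supn f"
    by (intro exI[of _ 3] allI impI ballI supn_least) (auto simp: semi_def intro!: sol_bound)
next
  fix e :: real assume e: "e > 0"
  obtain n where n: "(127 / 128 :: real) ^ n < e / 2"
    using real_arch_pow_inv[of "e / 2" "127 / 128"] e by auto
  have "dplus (semi t f) \<le> e * supn f" if t: "t \<ge> 5 * real n" and f: "f \<in> Eplus" for t f
  proof -
    have fE: "f \<in> Ecar" using f by (simp add: Eplus_def)
    have s0: "0 \<le> supn f" by (intro supn_nonneg EcarD(1) fE)
    have "const_fun (mass f / 2) \<in> Eplus"
      using mass_nonneg[OF f] const_fun_in_Ecar by (auto simp: Eplus_def nonneg_def const_fun_def)
    then have "dplus (semi t f) \<le> supn (\<lambda>x. semi t f x - const_fun (mass f / 2) x)"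
      by (intro dplus_le semi_in_Ecar fE)
    also have "\<dots> \<le> (127 / 128) ^ n * (2 * supn f)"
      using t by (intro supn_least) (auto simp: semi_def const_fun_def intro!: sol_decay fE)
    also have "\<dots> \<le> e / 2 * (2 * supn f)"
      using n s0 by (intro mult_right_mono) auto
    finally show ?thesis by simp
  qed
  then show "\<exists>t0. \<forall>t\<ge>t0. \<forall>f\<in>Eplus. dplus (semi t f) \<le> e * supn f"
    by (intro exI[of _ "5 * real n"]) simp
qed

text \<open>A positive function in the kernel of the spectral projection.\<close>
definition bump :: "real \<Rightarrow> complex" where
  "bump x = of_real (max 0 (- x * (x + 1)))"

lemma bump_eq_0: "x \<notin> {-1<..<0} \<Longrightarrow> bump x = 0"
proof -
  assume "x \<notin> {-1<..<0}"
  then have "0 \<le> x * (x + 1)" by (cases "x \<ge> 0") (auto intro: mult_nonpos_nonpos)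
  then show ?thesis by (simp add: bump_def)
qed

lemma bump_in_Eplus: "bump \<in> Eplus"
proof -
  have "continuous_on {-2..0} bump" unfolding bump_def by (intro continuous_intros)
  moreover have "nonneg bump" by (simp add: nonneg_def bump_def)
  ultimately show ?thesis using bump_eq_0 by (auto simp: Eplus_def Ecar_def)
qed

lemma mass_bump: "mass bump = 0"
proof -
  have "integral {-2..-1} bump = integral {-2..-1::real} (\<lambda>x. 0)"
    by (intro integral_cong) (simp add: bump_eq_0)
  then show ?thesis by (simp add: mass_def bump_eq_0)
qed

lemma sol_bump: "t \<ge> 0 \<Longrightarrow> sol bump t = - integral {t - 2..t - 1} (sol bump)"
  using renewal_sol[of bump] bump_in_Eplus by (simp add: renewal_def mass_bump Eplus_def)

lemma sol_bump_1: "sol bump 1 = - 1 / 6"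
proof -
  have "((\<lambda>x. - x * (x + 1)) has_integral (- (0 ^ 3 / 3 + 0 ^ 2 / 2) - (- ((-1) ^ 3 / 3 + (-1) ^ 2 / 2)))) {-1..0::real}"
    by (intro fundamental_theorem_of_calculus)
      (auto intro!: derivative_eq_intros simp: has_real_derivative_iff_has_vector_derivative[symmetric] field_simps power2_eq_square)
  from integral_unique[OF this] have "integral {-1..0} (\<lambda>x. - x * (x + 1)) = (1 / 6 :: real)"
    by (simp only:) simp
  moreover have "integral {-1..0} (sol bump) = integral {-1..0} (\<lambda>x. complex_of_real (- x * (x + 1)))"
  proof (intro integral_cong)
    fix x :: real assume x: "x \<in> {-1..0}"
    then have "x * (x + 1) \<le> 0" by (intro mult_nonpos_nonneg) auto
    then show "sol bump x = complex_of_real (- x * (x + 1))"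
      using x by (simp add: sol_init bump_def max_def)
  qed
  moreover have "integral {-1..0} (\<lambda>x. complex_of_real (- x * (x + 1)))
      = complex_of_real (integral {-1..0} (\<lambda>x. - x * (x + 1)))"
    by (intro integral_of_real_complex continuous_intros)
  ultimately have "integral {-1..0} (sol bump) = complex_of_real (1 / 6)"
    by (simp only:)
  then show ?thesis using sol_bump[of 1] by simp
qed

lemma semi_not_positive: "\<not> positive_opE (semi 1)"
proof
  assume "positive_opE (semi 1)"
  then have "nonneg (semi 1 bump)" using bump_in_Eplus by (simp add: positive_opE_def)
  then have "0 \<le> Re (semi 1 bump 0)" by (simp add: nonneg_def)
  then show False by (simp add: semi_def sol_bump_1)
qed

lemma quasi_interior_pos:
  assumes "quasi_interior u"
  shows "Re (u 0) > 0"
proof -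
  obtain f c where f: "f \<in> Ecar" "\<And>x. x \<in> {-2..0} \<Longrightarrow> cmod (f x) \<le> c * Re (u x)"
    "supn (\<lambda>x. const_fun 1 x - f x) < 1"
    using assms const_fun_in_Ecar[of 1] unfolding quasi_interior_def by (metis zero_less_one)
  have "cmod (const_fun 1 0 - f 0) < 1"
    using supn_upper[OF EcarD(1)[OF Ecar_diff[OF const_fun_in_Ecar f(1)]], of 0 1] f(3) by simp
  then have "f 0 \<noteq> 0" by (auto simp: const_fun_def)
  then have "Re (u 0) \<noteq> 0" using f(2)[of 0] by auto
  moreover have "Re (u 0) \<ge> 0" using assms by (auto simp: quasi_interior_def Eplus_def nonneg_def)
  ultimately show ?thesis by simp
qed

text \<open>Positivity on \<open>[t-2, t]\<close> contradicts \<open>v(t) = - \<integral>\<^bsub>t-2\<^esub>\<^bsup>t-1\<^esup> v\<close> for the orbit of \<^const>\<open>bump\<close>.\<close>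
lemma not_eventually_strongly_positive:
  assumes u: "quasi_interior u"
  shows "\<not> indiv_ev_strongly_positive semi u"
proof
  have fE: "bump \<in> Ecar" using bump_in_Eplus by (simp add: Eplus_def)
  have "bump (-1/2) \<noteq> 0" by (simp add: bump_def)
  then have "bump \<noteq> (\<lambda>x. 0)" by metis
  moreover assume "indiv_ev_strongly_positive semi u"
  ultimately obtain t0 where "t0 > 0"
      "\<And>t. t \<ge> t0 \<Longrightarrow> \<exists>c>0. nonneg (\<lambda>x. semi t bump x - complex_of_real c * u x)"
    using bump_in_Eplus unfolding indiv_ev_strongly_positive_def by blast
  then obtain t c where t: "t > 0" and c: "c > 0" "nonneg (\<lambda>x. semi t bump x - complex_of_real c * u x)"
    by blast
  have uE: "\<And>x. x \<in> {-2..0} \<Longrightarrow> Im (u x) = 0 \<and> 0 \<le> Re (u x)"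
    using u by (auto simp: quasi_interior_def Eplus_def nonneg_def)
  have v: "Im (sol bump s) = 0 \<and> c * Re (u (s - t)) \<le> Re (sol bump s)" if "s \<in> {t - 2..t}" for s
    using c(2) uE[of "s - t"] that by (auto simp: nonneg_def semi_def dest!: bspec[of _ _ "s - t"])
  have "0 \<le> Re (integral {t - 2..t - 1} (sol bump))"
  proof (intro conjunct2[OF integral_nonneg_complex] continuous_sol fE)
    fix s assume s: "s \<in> {t - 2..t - 1}"
    have "0 \<le> c * Re (u (s - t))" using c uE[of "s - t"] s by simp
    then show "Im (sol bump s) = 0 \<and> 0 \<le> Re (sol bump s)" using v[of s] s by auto
  qed
  moreover have "0 < c * Re (u 0)" using c(1) quasi_interior_pos[OF u] by simp
  ultimately show False using v[of t] sol_bump[of t] t by simp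
qed

lemma semigroup_properties:
  assumes T: "C0_semigroup T" "is_generator T DA opA"
  shows "unif_asym_positive T 0" "\<not> (\<forall>t\<ge>0. positive_opE (T t))"
    "\<not> (\<exists>u. quasi_interior u \<and> indiv_ev_strongly_positive T u)"
proof -
  note eq = semigroup_unique[OF T]
  have eqP: "T t f = semi t f" if "f \<in> Eplus" "t \<ge> 0" for t f
    using that by (intro eq) (auto simp: Eplus_def)
  show "unif_asym_positive T 0"
    unfolding unif_asym_positive_zero_iff
  proof (intro conjI allI impI)
    show "\<exists>M. \<forall>t\<ge>0. \<forall>f\<in>Ecar. supn (T t f) \<le> M * supn f"
      using unif_asym_positive_semi eq by (simp add: unif_asym_positive_zero_iff)
    fix e :: real assume "e > 0"
    then obtain t0 where "\<forall>t\<ge>t0. \<forall>f\<in>Eplus. dplus (semi t f) \<le> e * supn f"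
      using unif_asym_positive_semi unfolding unif_asym_positive_zero_iff by blast
    then show "\<exists>t0. \<forall>t\<ge>t0. \<forall>f\<in>Eplus. dplus (T t f) \<le> e * supn f"
      by (intro exI[of _ "max 0 t0"]) (simp add: eqP)
  qed
  show "\<not> (\<forall>t\<ge>0. positive_opE (T t))"
    using semi_not_positive eqP[of _ 1] unfolding positive_opE_def by (metis zero_le_one)
  show "\<not> (\<exists>u. quasi_interior u \<and> indiv_ev_strongly_positive T u)"
  proof clarify
    fix u assume u: "quasi_interior u" "indiv_ev_strongly_positive T u"
    have "indiv_ev_strongly_positive semi u"
      unfolding indiv_ev_strongly_positive_def
    proof (intro ballI impI)
      fix f assume f: "f \<in> Eplus" "f \<noteq> (\<lambda>x. 0)"
      then obtain t0 where "t0 > 0" "\<forall>t\<ge>t0. \<exists>c>0. nonneg (\<lambda>x. T t f x - complex_of_real c * u x)"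
        using u(2) unfolding indiv_ev_strongly_positive_def by blast
      then show "\<exists>t0>0. \<forall>t\<ge>t0. \<exists>c>0. nonneg (\<lambda>x. semi t f x - complex_of_real c * u x)"
        using eqP[OF f(1)] by (intro exI[of _ t0]) auto
    qed
    then show False using not_eventually_strongly_positive[OF u(1)] by blast
  qed
qed

subsection \<open>The spectrum\<close>

definition char_fun :: "complex \<Rightarrow> complex" where
  "char_fun \<mu> = \<mu> - exp (- 2 * \<mu>) + exp (- \<mu>)"

text \<open>With \<open>z = exp (-\<mu>/2)\<close>, a zero \<open>\<mu>\<close> satisfies \<open>\<bar>\<mu>\<bar> \<le> \<bar>z\<^sup>2 - 1\<bar> \<le> \<bar>\<mu>\<bar>/2 \<cdot> \<bar>z + 1\<bar>\<close>, forcing \<open>z = 1\<close>.\<close>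
lemma char_fun_nonzero:
  assumes "Re \<mu> \<ge> 0" "\<mu> \<noteq> 0"
  shows "char_fun \<mu> \<noteq> 0"
proof
  assume 0: "char_fun \<mu> = 0"
  define z where "z = exp (- \<mu> / 2)"
  have z1: "norm z \<le> 1" using assms by (simp add: z_def)
  have e1: "exp (- \<mu>) = z * z" by (simp add: z_def mult_exp_exp)
  have e2: "exp (- 2 * \<mu>) = exp (- \<mu>) * exp (- \<mu>)" by (simp add: mult_exp_exp)
  have "norm (exp (- \<mu> / 2) - exp 0) \<le> 1 * norm (- \<mu> / 2 - 0)"
  proof (rule field_differentiable_bound[of "{z. Re z \<le> 0}"])
    show "convex {z. Re z \<le> 0}" by (rule convex_halfspace_Re_le)
    show "(exp has_field_derivative exp w) (at w within {z. Re z \<le> 0})" for w :: complex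
      by (auto intro: derivative_eq_intros DERIV_exp has_field_derivative_at_within)
    show "norm (exp w) \<le> 1" if "w \<in> {z. Re z \<le> 0}" for w
      using that by simp
  qed (use assms in auto)
  then have z2: "norm (z - 1) \<le> norm \<mu> / 2" by (simp add: z_def norm_divide)
  have "\<mu> = exp (- \<mu>) * ((z - 1) * (z + 1))"
    using 0 unfolding char_fun_def e2 by (simp add: e1 algebra_simps)
  then have "norm \<mu> = norm (exp (- \<mu>)) * (norm (z - 1) * norm (z + 1))"
    by (metis norm_mult)
  also have "\<dots> \<le> 1 * (norm \<mu> / 2 * norm (z + 1))"
    using assms z2 by (intro mult_mono) auto
  finally have "norm (z + 1) \<ge> 2" using assms by simp
  then have "4 \<le> (norm (z + 1))\<^sup>2" using power_mono[of 2 "norm (z + 1)" 2] by simp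
  moreover have "(norm z)\<^sup>2 \<le> 1" using z1 by (simp add: power_le_one)
  ultimately have "4 \<le> (Re z + 1)\<^sup>2 + (Im z)\<^sup>2" "(Re z)\<^sup>2 + (Im z)\<^sup>2 \<le> 1"
    by (simp_all add: cmod_power2)
  then have "1 \<le> Re z" by (simp add: power2_eq_square algebra_simps)
  moreover from this have "1 \<le> (Re z)\<^sup>2" by (simp add: one_le_power)
  ultimately have "Im z = 0" "(Re z)\<^sup>2 = 1"
    using \<open>(Re z)\<^sup>2 + (Im z)\<^sup>2 \<le> 1\<close> by (smt (verit) zero_le_power2 zero_eq_power2)+
  then have "z = 1" using \<open>1 \<le> Re z\<close> by (auto simp: complex_eq_iff power2_eq_1_iff)
  then have "norm \<mu> \<le> 0"
    using \<open>norm \<mu> = norm (exp (- \<mu>)) * (norm (z - 1) * norm (z + 1))\<close> by simp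
  then show False using assms by simp
qed

lemma char_fun_0 [simp]: "char_fun 0 = 0"
  by (simp add: char_fun_def)

lemma char_fun_derivative: "(char_fun has_field_derivative 1 + 2 * exp (- 2 * \<mu>) - exp (- \<mu>)) (at \<mu>)"
  unfolding char_fun_def by (auto intro!: derivative_eq_intros)

lemma char_fun_holomorphic: "char_fun holomorphic_on S"
  unfolding char_fun_def by (intro holomorphic_intros)

definition exp_tail :: "complex \<Rightarrow> (real \<Rightarrow> complex) \<Rightarrow> real \<Rightarrow> complex" where
  "exp_tail \<mu> g x = integral {x..0} (\<lambda>s. exp (- \<mu> * of_real s) * g s)"

definition numer :: "(real \<Rightarrow> complex) \<Rightarrow> complex \<Rightarrow> complex" where
  "numer g \<mu> = g 0 + exp (- 2 * \<mu>) * exp_tail \<mu> g (-2) - exp (- \<mu>) * exp_tail \<mu> g (-1)"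

definition exp_sol :: "complex \<Rightarrow> (real \<Rightarrow> complex) \<Rightarrow> complex \<Rightarrow> real \<Rightarrow> complex" where
  "exp_sol \<mu> g c x = (if x \<in> {-2..0} then exp (\<mu> * of_real x) * (c + exp_tail \<mu> g x) else 0)"

lemma exp_tail_derivative:
  assumes "g \<in> Ecar" "x \<in> {-2..0}"
  shows "(exp_tail \<mu> g has_vector_derivative - (exp (- \<mu> * of_real x) * g x)) (at x within {-2..0})"
  unfolding exp_tail_def
  using integral_has_vector_derivative'[of "-2" 0 "\<lambda>s. exp (- \<mu> * of_real s) * g s" x] assms
  by (simp add: continuous_intros EcarD(1))

lemma exp_real_derivative:
  "((\<lambda>x. exp (\<mu> * complex_of_real x)) has_vector_derivative \<mu> * exp (\<mu> * of_real x)) (at x within S)"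
  by (rule has_vector_derivative_real_field) (auto intro!: derivative_eq_intros)

lemma exp_sol_in_Ecar:
  assumes "g \<in> Ecar"
  shows "exp_sol \<mu> g c \<in> Ecar"
proof -
  have "continuous_on {-2..0} (exp_tail \<mu> g)"
    using exp_tail_derivative[OF assms] by (meson continuous_on_eq_continuous_within has_vector_derivative_continuous)
  then show ?thesis unfolding exp_sol_def by (intro Ecar_restrictI continuous_intros)
qed

lemma exp_sol_derivative:
  assumes g: "g \<in> Ecar" and x: "x \<in> {-2..0}"
  shows "(exp_sol \<mu> g c has_vector_derivative \<mu> * exp_sol \<mu> g c x - g x) (at x within {-2..0})"
proof -
  have "((\<lambda>x. exp (\<mu> * of_real x) * (c + exp_tail \<mu> g x)) has_vector_derivative
      exp (\<mu> * of_real x) * (0 + - (exp (- \<mu> * of_real x) * g x)) +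
      \<mu> * exp (\<mu> * of_real x) * (c + exp_tail \<mu> g x)) (at x within {-2..0})"
    by (intro derivative_intros has_vector_derivative_mult exp_real_derivative exp_tail_derivative g x)
  moreover have "exp (\<mu> * of_real x) * (0 + - (exp (- \<mu> * of_real x) * g x)) +
      \<mu> * exp (\<mu> * of_real x) * (c + exp_tail \<mu> g x) = \<mu> * exp_sol \<mu> g c x - g x"
    using x by (simp add: exp_sol_def mult.assoc[symmetric] mult_exp_exp)
  ultimately have "((\<lambda>x. exp (\<mu> * of_real x) * (c + exp_tail \<mu> g x)) has_vector_derivative
      \<mu> * exp_sol \<mu> g c x - g x) (at x within {-2..0})" by simp
  then show ?thesis
    by (rule has_vector_derivative_transform[rotated 2]) (use x in \<open>auto simp: exp_sol_def\<close>)
qed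

lemma exp_tail_0 [simp]: "exp_tail \<mu> g 0 = 0"
  by (simp add: exp_tail_def)

lemma exp_sol_in_DA:
  assumes g: "g \<in> Ecar" and c: "c * char_fun \<mu> = numer g \<mu>"
  shows "exp_sol \<mu> g c \<in> DA" "opA (exp_sol \<mu> g c) = (\<lambda>x. \<mu> * exp_sol \<mu> g c x - g x)"
proof -
  have E: "(\<lambda>x. \<mu> * exp_sol \<mu> g c x - g x) \<in> Ecar"
    by (intro Ecar_diff Ecar_mult exp_sol_in_Ecar g)
  have b: "\<mu> * exp_sol \<mu> g c 0 - g 0 = exp_sol \<mu> g c (-2) - exp_sol \<mu> g c (-1)"
    using c by (simp add: exp_sol_def char_fun_def numer_def algebra_simps)
  show "exp_sol \<mu> g c \<in> DA" "opA (exp_sol \<mu> g c) = (\<lambda>x. \<mu> * exp_sol \<mu> g c x - g x)"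
    using DA_I[OF exp_sol_in_Ecar[OF g] E exp_sol_derivative[OF g] b] by auto
qed

lemma resolvent_equation_solution:
  assumes f: "f \<in> DA" and g: "g \<in> Ecar" and eq: "\<And>x. \<mu> * f x - opA f x = g x"
  shows "f = exp_sol \<mu> g (f 0)" "f 0 * char_fun \<mu> = numer g \<mu>"
proof -
  have "((\<lambda>x. exp (- \<mu> * of_real x) * f x - exp_tail \<mu> g x) has_vector_derivative 0) (at x within {-2..0})"
    if x: "x \<in> {-2..0}" for x
  proof -
    have "((\<lambda>x. exp (- \<mu> * of_real x) * f x - exp_tail \<mu> g x) has_vector_derivative
       exp (- \<mu> * of_real x) * opA f x + - \<mu> * exp (- \<mu> * of_real x) * f x
        - - (exp (- \<mu> * of_real x) * g x)) (at x within {-2..0})"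
      by (intro derivative_intros has_vector_derivative_mult exp_real_derivative exp_tail_derivative
          DA_derivative(2) f g x)
    then show ?thesis by (simp add: eq[symmetric] algebra_simps)
  qed
  from has_vector_derivative_zero_constant[OF convex_real_interval(5) this]
  obtain c where c: "\<And>x. x \<in> {-2..0} \<Longrightarrow> exp (- \<mu> * of_real x) * f x - exp_tail \<mu> g x = c"
    by blast
  have "c = f 0" using c[of 0] by simp
  have fx: "f x = exp (\<mu> * of_real x) * (f 0 + exp_tail \<mu> g x)" if "x \<in> {-2..0}" for x
  proof -
    have "f x = exp (\<mu> * of_real x) * (exp (- \<mu> * of_real x) * f x)"
      by (simp add: mult.assoc[symmetric] mult_exp_exp)
    also have "exp (- \<mu> * of_real x) * f x = f 0 + exp_tail \<mu> g x"
      using c[OF that] \<open>c = f 0\<close> by (simp add: algebra_simps)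
    finally show ?thesis .
  qed
  show "f = exp_sol \<mu> g (f 0)"
    using f DA_subset by (intro Ecar_eqI exp_sol_in_Ecar g) (auto simp: exp_sol_def intro: fx)
  have "\<mu> * f 0 - g 0 = f (-2) - f (-1)"
    using DA_derivative(3)[OF f] eq[of 0] by (simp add: algebra_simps)
  then show "f 0 * char_fun \<mu> = numer g \<mu>"
    using fx[of "-2"] fx[of "-1"] by (simp add: char_fun_def numer_def algebra_simps)
qed

definition resolv :: "complex \<Rightarrow> (real \<Rightarrow> complex) \<Rightarrow> real \<Rightarrow> complex" where
  "resolv \<mu> g = exp_sol \<mu> g (numer g \<mu> / char_fun \<mu>)"

lemma resolv_unique:
  assumes "char_fun \<mu> \<noteq> 0" "g \<in> Ecar"
  shows "f \<in> DA \<and> (\<forall>x. \<mu> * f x - opA f x = g x) \<longleftrightarrow> f = resolv \<mu> g"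
proof
  assume "f \<in> DA \<and> (\<forall>x. \<mu> * f x - opA f x = g x)"
  then show "f = resolv \<mu> g"
    using resolvent_equation_solution[of f g \<mu>] assms by (simp add: resolv_def nonzero_eq_divide_eq[symmetric])
next
  assume "f = resolv \<mu> g"
  then show "f \<in> DA \<and> (\<forall>x. \<mu> * f x - opA f x = g x)"
    using exp_sol_in_DA[OF assms(2), of "numer g \<mu> / char_fun \<mu>" \<mu>] assms by (simp add: resolv_def)
qed

lemma resolventE_eq:
  assumes "char_fun \<mu> \<noteq> 0" "g \<in> Ecar"
  shows "resolventE DA opA \<mu> g = resolv \<mu> g"
  unfolding resolventE_def resolv_unique[OF assms] by simp

lemma exp_tail_linear:
  assumes "f \<in> Ecar" "g \<in> Ecar" "x \<in> {-2..0}"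
  shows "exp_tail \<mu> (\<lambda>x. f x + g x) x = exp_tail \<mu> f x + exp_tail \<mu> g x"
    "exp_tail \<mu> (\<lambda>x. c * f x) x = c * exp_tail \<mu> f x"
proof -
  have i: "(\<lambda>s. exp (- \<mu> * of_real s) * h s) integrable_on {x..0}" if "h \<in> Ecar" for h
    using that assms(3) by (intro integrable_continuous_real continuous_intros continuous_on_subset[OF EcarD(1)]) auto
  show "exp_tail \<mu> (\<lambda>x. f x + g x) x = exp_tail \<mu> f x + exp_tail \<mu> g x"
    unfolding exp_tail_def distrib_left by (rule integral_add[OF i i]) (use assms in auto)
  show "exp_tail \<mu> (\<lambda>x. c * f x) x = c * exp_tail \<mu> f x"
    unfolding exp_tail_def by (simp add: mult.left_commute[of _ c])
qed

lemma norm_exp_real_le: "x \<in> {-2..0} \<Longrightarrow> norm (exp (\<mu> * complex_of_real x)) \<le> exp (2 * norm \<mu>)"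
proof -
  assume x: "x \<in> {-2..0}"
  have "norm (exp (\<mu> * complex_of_real x)) \<le> exp (norm (\<mu> * complex_of_real x))"
    by (rule norm_exp)
  also have "\<dots> \<le> exp (2 * norm \<mu>)"
    using x mult_left_mono[of "\<bar>x\<bar>" 2 "norm \<mu>"] by (simp add: norm_mult mult.commute[of 2])
  finally show ?thesis .
qed

lemma exp_tail_bound:
  assumes g: "g \<in> Ecar" and x: "x \<in> {-2..0}"
  shows "norm (exp_tail \<mu> g x) \<le> 2 * exp (2 * norm \<mu>) * supn g"
proof -
  have s0: "0 \<le> supn g" by (intro supn_nonneg EcarD(1) g)
  have "norm (exp_tail \<mu> g x) \<le> (exp (2 * norm \<mu>) * supn g) * (0 - x)"
    unfolding exp_tail_def
  proof (rule integral_bound)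
    show "continuous_on {x..0} (\<lambda>s. exp (- \<mu> * of_real s) * g s)"
      using x by (intro continuous_intros continuous_on_subset[OF EcarD(1)[OF g]]) auto
    show "norm (exp (- \<mu> * of_real s) * g s) \<le> exp (2 * norm \<mu>) * supn g" if "s \<in> {x..0}" for s
      unfolding norm_mult using norm_exp_real_le[of s "- \<mu>"] supn_upper[OF EcarD(1)[OF g], of s] that x
      by (intro mult_mono) auto
  qed (use x in auto)
  also have "\<dots> \<le> (exp (2 * norm \<mu>) * supn g) * 2"
    using x s0 by (intro mult_left_mono) auto
  finally show ?thesis by simp
qed

lemma resolv_bound: "\<exists>M\<ge>0. \<forall>g\<in>Ecar. \<forall>x\<in>{-2..0}. norm (resolv \<mu> g x) \<le> M * supn g"
proof -
  define E where "E = exp (2 * norm \<mu>)"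
  have E: "E > 0" by (simp add: E_def)
  define C where "C = (1 + E * (2 * E) + E * (2 * E)) / norm (char_fun \<mu>)"
  have "norm (resolv \<mu> g x) \<le> (E * (C + 2 * E)) * supn g" if g: "g \<in> Ecar" and x: "x \<in> {-2..0}" for g x
  proof -
    have s0: "0 \<le> supn g" by (intro supn_nonneg EcarD(1) g)
    have e: "norm (exp (- 2 * \<mu>)) \<le> E" "norm (exp (- \<mu>)) \<le> E"
      using norm_exp_real_le[of "-2" \<mu>] norm_exp_real_le[of "-1" \<mu>] by (simp_all add: E_def mult.commute)
    have t: "norm (exp_tail \<mu> g x) \<le> 2 * E * supn g" if "x \<in> {-2..0}" for x
      using exp_tail_bound[OF g that] by (simp add: E_def)
    have "norm (numer g \<mu>) \<le> norm (g 0) + norm (exp (- 2 * \<mu>) * exp_tail \<mu> g (-2))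
        + norm (exp (- \<mu>) * exp_tail \<mu> g (-1))"
      unfolding numer_def by (meson norm_triangle_ineq norm_triangle_ineq4 add_mono_thms_linordered_semiring(3) order_trans)
    also have "\<dots> \<le> supn g + E * (2 * E * supn g) + E * (2 * E * supn g)"
      unfolding norm_mult using e t E s0 supn_upper[OF EcarD(1)[OF g], of 0]
      by (intro add_mono mult_mono) auto
    finally have "norm (numer g \<mu> / char_fun \<mu>) \<le> (supn g + E * (2 * E * supn g) + E * (2 * E * supn g)) / norm (char_fun \<mu>)"
      unfolding norm_divide by (intro divide_right_mono) auto
    also have "\<dots> = C * supn g" by (simp add: C_def algebra_simps)
    finally have c: "norm (numer g \<mu> / char_fun \<mu>) \<le> C * supn g" .
    have "norm (resolv \<mu> g x) = norm (exp (\<mu> * of_real x)) * norm (numer g \<mu> / char_fun \<mu> + exp_tail \<mu> g x)"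
      using x by (simp add: resolv_def exp_sol_def norm_mult)
    also have "\<dots> \<le> E * (C * supn g + 2 * E * supn g)"
      using norm_exp_real_le[OF x, of \<mu>] c t[OF x] E s0
      by (intro mult_mono order_trans[OF norm_triangle_ineq] add_mono) (auto simp: E_def)
    finally show ?thesis by (simp add: algebra_simps)
  qed
  moreover have "E * (C + 2 * E) \<ge> 0" using E by (simp add: C_def)
  ultimately show ?thesis by blast
qed

lemma bounded_resolv: "bounded_opE (resolv \<mu>)"
  unfolding bounded_opE_def
proof (intro conjI ballI allI)
  fix f g assume fg: "f \<in> Ecar" "g \<in> Ecar"
  show "resolv \<mu> (\<lambda>x. f x + g x) = (\<lambda>x. resolv \<mu> f x + resolv \<mu> g x)"
    by (rule ext) (simp add: resolv_def exp_sol_def numer_def exp_tail_linear(1)[OF fg] add_divide_distrib diff_divide_distrib algebra_simps)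
next
  fix f and c :: complex assume f: "f \<in> Ecar"
  show "resolv \<mu> (\<lambda>x. c * f x) = (\<lambda>x. c * resolv \<mu> f x)"
    by (rule ext) (simp add: resolv_def exp_sol_def numer_def exp_tail_linear(2)[OF f f] add_divide_distrib diff_divide_distrib algebra_simps)
next
  obtain M where "\<forall>g\<in>Ecar. \<forall>x\<in>{-2..0}. norm (resolv \<mu> g x) \<le> M * supn g"
    using resolv_bound by blast
  then show "\<exists>M. \<forall>f\<in>Ecar. supn (resolv \<mu> f) \<le> M * supn f"
    by (intro exI[of _ M] ballI supn_least) auto
qed (simp add: resolv_def exp_sol_in_Ecar)

lemma bounded_opE_cong:
  assumes "bounded_opE S" "\<And>f. f \<in> Ecar \<Longrightarrow> T f = S f"
  shows "bounded_opE T"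
  using assms by (simp add: bounded_opE_def Ecar_add Ecar_mult)

lemma resolvent_setE_eq: "resolvent_setE DA opA = {\<mu>. char_fun \<mu> \<noteq> 0}"
proof (intro equalityI subsetI)
  fix \<mu> assume "\<mu> \<in> {\<mu>. char_fun \<mu> \<noteq> 0}"
  then have \<mu>: "char_fun \<mu> \<noteq> 0" by simp
  have "bounded_opE (resolventE DA opA \<mu>)"
    by (rule bounded_opE_cong[OF bounded_resolv resolventE_eq[OF \<mu>]])
  then show "\<mu> \<in> resolvent_setE DA opA"
    unfolding resolvent_setE_def using resolv_unique[OF \<mu>] by simp
next
  fix \<mu> assume \<mu>: "\<mu> \<in> resolvent_setE DA opA"
  have "char_fun \<mu> \<noteq> 0"
  proof
    assume 0: "char_fun \<mu> = 0"
    have n: "c * char_fun \<mu> = numer (\<lambda>x. 0) \<mu>" for c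
      by (simp add: 0 numer_def exp_tail_def)
    have "exp_sol \<mu> (\<lambda>x. 0) c \<in> DA \<and> (\<forall>x. \<mu> * exp_sol \<mu> (\<lambda>x. 0) c x - opA (exp_sol \<mu> (\<lambda>x. 0) c) x = 0)" for c
      using exp_sol_in_DA[OF zero_in_Ecar n] by simp
    moreover have "\<forall>g\<in>Ecar. \<exists>!f. f \<in> DA \<and> (\<forall>x. \<mu> * f x - opA f x = g x)"
      using \<mu> by (simp add: resolvent_setE_def)
    note bspec[OF this zero_in_Ecar]
    ultimately have "exp_sol \<mu> (\<lambda>x. 0) 0 = exp_sol \<mu> (\<lambda>x. 0) 1" by blast
    from fun_cong[OF this, of 0] show False by (simp add: exp_sol_def)
  qed
  then show "\<mu> \<in> {\<mu>. char_fun \<mu> \<noteq> 0}" by simp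
qed

lemma spectrum_eq: "spectrum_op DA opA = {\<mu>. char_fun \<mu> = 0}"
  by (auto simp: spectrum_op_def resolvent_setE_eq)

lemma compact_resolvent:
  assumes \<mu>: "char_fun \<mu> \<noteq> 0"
  shows "compact_opE (resolventE DA opA \<mu>)"
  unfolding compact_opE_def
proof (intro conjI allI impI)
  show "bounded_opE (resolventE DA opA \<mu>)"
    by (rule bounded_opE_cong[OF bounded_resolv resolventE_eq[OF \<mu>]])
  fix u :: "nat \<Rightarrow> real \<Rightarrow> complex"
  assume "(\<forall>n. u n \<in> Ecar) \<and> (\<exists>B. \<forall>n. supn (u n) \<le> B)"
  then obtain B where u: "\<And>n. u n \<in> Ecar" and B: "\<And>n. supn (u n) \<le> B" by blast
  obtain M where M: "M \<ge> 0" "\<And>g x. g \<in> Ecar \<Longrightarrow> x \<in> {-2..0} \<Longrightarrow> norm (resolv \<mu> g x) \<le> M * supn g"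
    using resolv_bound by blast
  have bd: "norm (resolv \<mu> (u n) x) \<le> M * B" if "x \<in> {-2..0}" for n x
    using M(2)[OF u that, of n] mult_left_mono[OF B M(1), of n] by linarith
  define L where "L = norm \<mu> * (M * B) + B"
  have lip: "norm (resolv \<mu> (u n) x - resolv \<mu> (u n) y) \<le> L * norm (x - y)"
    if "x \<in> {-2..0}" "y \<in> {-2..0}" for n x y
  proof (rule vector_derivative_norm_bound[OF _ _ _ that])
    fix s :: real assume s: "s \<in> {-2..0}"
    show "(resolv \<mu> (u n) has_vector_derivative \<mu> * resolv \<mu> (u n) s - u n s) (at s within {-2..0})"
      unfolding resolv_def by (rule exp_sol_derivative[OF u s])
    have "norm (\<mu> * resolv \<mu> (u n) s - u n s) \<le> norm (\<mu> * resolv \<mu> (u n) s) + norm (u n s)"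
      by (rule norm_triangle_ineq4)
    also have "\<dots> \<le> L"
      unfolding L_def norm_mult using bd[OF s, of n] supn_upper[OF EcarD(1)[OF u] s, of n] B[of n]
      by (intro add_mono mult_left_mono) auto
    finally show "norm (\<mu> * resolv \<mu> (u n) s - u n s) \<le> L" .
  qed auto
  have L0: "L \<ge> 0" using lip[of 0 "-1" 0] norm_ge_zero by (smt (verit) atLeastAtMost_iff mult_cancel_left1 real_norm_def)
  obtain g k where k: "strict_mono (k :: nat \<Rightarrow> nat)"
    and conv: "\<And>e. 0 < e \<Longrightarrow> \<exists>N. \<forall>n x. n \<ge> N \<and> x \<in> {-2..0} \<longrightarrow> norm (resolv \<mu> (u (k n)) x - g x) < e"
  proof (rule Arzela_Ascoli[of "{-2..0}" "\<lambda>n. resolv \<mu> (u n)" "M * B"])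
    fix x e :: real assume x: "x \<in> {-2..0}" and e: "0 < e"
    show "\<exists>d>0. \<forall>n y. y \<in> {-2..0} \<and> norm (x - y) < d \<longrightarrow> norm (resolv \<mu> (u n) x - resolv \<mu> (u n) y) < e"
    proof (intro exI[of _ "e / (L + 1)"] conjI allI impI)
      fix n y assume y: "y \<in> {-2..0} \<and> norm (x - y) < e / (L + 1)"
      have "norm (resolv \<mu> (u n) x - resolv \<mu> (u n) y) \<le> L * norm (x - y)" using lip x y by blast
      also have "\<dots> \<le> L * (e / (L + 1))" using y L0 by (intro mult_left_mono) auto
      also have "\<dots> < e" using e L0 by (simp add: field_simps)
      finally show "norm (resolv \<mu> (u n) x - resolv \<mu> (u n) y) < e" .
    qed (use e L0 in auto)
  qed (use bd in auto)
  have "\<exists>N. \<forall>m\<ge>N. \<forall>n\<ge>N. supn (\<lambda>x. resolv \<mu> (u (k m)) x - resolv \<mu> (u (k n)) x) < e" if e: "e > 0" for e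
  proof -
    obtain N where N: "\<And>n x. n \<ge> N \<Longrightarrow> x \<in> {-2..0} \<Longrightarrow> norm (resolv \<mu> (u (k n)) x - g x) < e / 3"
      using conv[of "e / 3"] e by auto
    have "supn (\<lambda>x. resolv \<mu> (u (k m)) x - resolv \<mu> (u (k n)) x) \<le> e / 3 + e / 3" if "m \<ge> N" "n \<ge> N" for m n
    proof (rule supn_least)
      fix x :: real assume x: "x \<in> {-2..0}"
      show "norm (resolv \<mu> (u (k m)) x - resolv \<mu> (u (k n)) x) \<le> e / 3 + e / 3"
        using norm_diff_triangle_ineq[of "resolv \<mu> (u (k m)) x" "- g x" "resolv \<mu> (u (k n)) x" "- g x"]
          N[OF that(1) x] N[OF that(2) x] norm_triangle_ineq4[of "resolv \<mu> (u (k m)) x - g x" "resolv \<mu> (u (k n)) x - g x"]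
        by simp
    qed
    moreover have "e / 3 + e / 3 < e" using e by simp
    ultimately show ?thesis by (meson le_less_trans)
  qed
  then show "\<exists>r. strict_mono (r :: nat \<Rightarrow> nat) \<and> (\<forall>e>0. \<exists>N. \<forall>m\<ge>N. \<forall>n\<ge>N.
      supn (\<lambda>x. resolventE DA opA \<mu> (u (r m)) x - resolventE DA opA \<mu> (u (r n)) x) < e)"
    using k by (intro exI[of _ k]) (simp add: resolventE_eq[OF \<mu> u])
qed

lemma exp_tail_holomorphic:
  assumes g: "g \<in> Ecar" and x: "x \<in> {-2..0}"
  shows "(\<lambda>\<mu>. exp_tail \<mu> g x) holomorphic_on UNIV"
proof -
  have cg: "continuous_on (cbox x 0) g"
    using x by (intro continuous_on_subset[OF EcarD(1)[OF g]]) auto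
  have "(\<lambda>\<mu>. integral (cbox x 0) (\<lambda>s. exp (- \<mu> * of_real s) * g s)) holomorphic_on UNIV"
  proof (rule leibniz_rule_holomorphic[where fx = "\<lambda>\<mu> s. - of_real s * exp (- \<mu> * of_real s) * g s"])
    show "((\<lambda>\<mu>. exp (- \<mu> * of_real s) * g s) has_field_derivative
        - of_real s * exp (- \<mu> * of_real s) * g s) (at \<mu> within UNIV)" for \<mu> s
      by (auto intro!: derivative_eq_intros)
    show "(\<lambda>s. exp (- \<mu> * of_real s) * g s) integrable_on cbox x 0" for \<mu>
      by (intro integrable_continuous continuous_intros cg)
    have "continuous_on (UNIV \<times> cbox x 0) (\<lambda>p. - of_real (snd p) * exp (- fst p * of_real (snd p)) * g (snd p))"
      by (intro continuous_intros continuous_on_compose2[OF cg]) auto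
    then show "continuous_on (UNIV \<times> cbox x 0) (\<lambda>(\<mu>, s). - of_real s * exp (- \<mu> * of_real s) * g s)"
      by (simp add: case_prod_beta)
  qed auto
  then show ?thesis by (simp add: exp_tail_def)
qed

lemma numer_0:
  assumes "g \<in> Ecar"
  shows "numer g 0 = mass g"
proof -
  have "integral {-2..0} g = integral {-2..-1} g + integral {-1..0} g"
    using assms by (intro Henstock_Kurzweil_Integration.integral_combine[symmetric] Ecar_integrable) auto
  then show ?thesis by (simp add: numer_def exp_tail_def mass_def)
qed

lemma char_fun_nonzero_cball:
  assumes "cball 0 r \<inter> spectrum_op DA opA = {0}" "norm \<mu> \<le> r" "\<mu> \<noteq> 0"
  shows "char_fun \<mu> \<noteq> 0"
proof
  assume "char_fun \<mu> = 0"
  then have "\<mu> \<in> cball 0 r \<inter> spectrum_op DA opA" using assms(2) by (simp add: spectrum_eq)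
  then show False using assms(1,3) by blast
qed

lemma resolvent_contour_integral:
  assumes r: "r > 0" and sp: "cball 0 r \<inter> spectrum_op DA opA = {0}" and g: "g \<in> Ecar" and x: "x \<in> {-2..0}"
  shows "contour_integral (circlepath 0 r) (\<lambda>\<mu>. resolventE DA opA \<mu> g x) = 2 * of_real pi * \<i> * (mass g / 2)"
proof -
  note nz = char_fun_nonzero_cball[OF sp]
  define q where "q \<mu> = (if \<mu> = 0 then deriv char_fun 0 else (char_fun \<mu> - char_fun 0) / (\<mu> - 0))" for \<mu>
  have q: "q holomorphic_on UNIV"
    unfolding q_def by (rule pole_lemma[OF char_fun_holomorphic]) simp
  have q0: "q 0 = 2"
    unfolding q_def using DERIV_imp_deriv[OF char_fun_derivative[of 0]] by simp
  have qnz: "q \<mu> \<noteq> 0" if "norm \<mu> \<le> r" for \<mu>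
    using nz[OF that] q0 by (cases "\<mu> = 0") (auto simp: q_def)
  define \<Phi> where "\<Phi> \<mu> = exp (\<mu> * of_real x) * (numer g \<mu> + char_fun \<mu> * exp_tail \<mu> g x)" for \<mu>
  have \<Phi>: "\<Phi> holomorphic_on UNIV"
    unfolding \<Phi>_def numer_def
    by (intro holomorphic_intros char_fun_holomorphic exp_tail_holomorphic g x) auto
  have h: "(\<lambda>\<mu>. \<Phi> \<mu> / q \<mu>) holomorphic_on cball 0 r"
    using qnz by (intro holomorphic_intros holomorphic_on_subset[OF \<Phi>] holomorphic_on_subset[OF q]) auto
  have "((\<lambda>\<mu>. \<Phi> \<mu> / q \<mu> / (\<mu> - 0)) has_contour_integral (2 * of_real pi * \<i> * (\<Phi> 0 / q 0))) (circlepath 0 r)"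
    by (rule Cauchy_integral_circlepath)
      (use r h in \<open>auto intro: holomorphic_on_imp_continuous_on holomorphic_on_subset[OF _ ball_subset_cball]\<close>)
  moreover have "\<Phi> \<mu> / q \<mu> / (\<mu> - 0) = resolventE DA opA \<mu> g x"
    if "\<mu> \<in> path_image (circlepath 0 r)" for \<mu>
  proof -
    have \<mu>: "\<mu> \<noteq> 0" "char_fun \<mu> \<noteq> 0" using that r nz[of \<mu>] by (auto simp: path_image_circlepath)
    then show ?thesis
      using x by (simp add: resolventE_eq[OF \<mu>(2) g] resolv_def exp_sol_def \<Phi>_def q_def field_simps)
  qed
  ultimately have "((\<lambda>\<mu>. resolventE DA opA \<mu> g x) has_contour_integral (2 * of_real pi * \<i> * (\<Phi> 0 / q 0))) (circlepath 0 r)"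
    by (rule has_contour_integral_eq)
  then show ?thesis
    by (simp add: contour_integral_unique q0 \<Phi>_def numer_0[OF g])
qed

lemma spectral_proj_eq:
  assumes r: "r > 0" and sp: "cball 0 r \<inter> spectrum_op DA opA = {0}" and g: "g \<in> Ecar"
  shows "spectral_proj DA opA 0 r g = const_fun (mass g / 2)"
proof
  fix x
  show "spectral_proj DA opA 0 r g x = const_fun (mass g / 2) x"
  proof (cases "x \<in> {-2..0}")
    case True
    then show ?thesis
      unfolding spectral_proj_def using resolvent_contour_integral[OF r sp g True]
      by (simp add: const_fun_def)
  next
    case False
    have "contour_integral (circlepath 0 r) (\<lambda>\<mu>. resolventE DA opA \<mu> g x)
        = contour_integral (circlepath 0 r) (\<lambda>\<mu>. 0)"
    proof (rule contour_integral_cong)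
      fix \<mu> assume "\<mu> \<in> path_image (circlepath 0 r)"
      then have "norm \<mu> = r" "\<mu> \<noteq> 0" using r by (auto simp: path_image_circlepath)
      then have "char_fun \<mu> \<noteq> 0" using char_fun_nonzero_cball[OF sp] by simp
      then show "resolventE DA opA \<mu> g x = 0"
        using False by (auto simp: resolventE_eq g resolv_def exp_sol_def)
    qed simp
    then show ?thesis using False by (auto simp: spectral_proj_def const_fun_def)
  qed
qed

lemma isolated_zero: "\<exists>r>0. cball 0 r \<inter> spectrum_op DA opA = {0}"
proof -
  obtain r where r: "0 < r" "\<And>z. z \<in> ball 0 r - {0} \<Longrightarrow> char_fun z \<noteq> 0"
    using isolated_zeros[of char_fun UNIV 0 1] char_fun_holomorphic char_fun_nonzero[of 1] by auto
  have "z = 0" if "char_fun z = 0" "z \<in> cball 0 (r / 2)" for z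
    using r(2)[of z] that r(1) by auto
  then have "cball 0 (r / 2) \<inter> spectrum_op DA opA = {0}"
    using r(1) by (auto simp: spectrum_eq)
  then show ?thesis using r(1) by (intro exI[of _ "r / 2"]) auto
qed

lemma mass_const: "mass (const_fun c) = 2 * c"
proof -
  have "integral {-2..-1} (const_fun c) = integral {-2..-1::real} (\<lambda>x. c)"
    by (intro integral_cong) (simp add: const_fun_def)
  then show ?thesis by (simp add: mass_def const_fun_def)
qed

lemma const_fun_in_DA: "const_fun c \<in> DA" "opA (const_fun c) = (\<lambda>x. 0)"
proof -
  have "(const_fun c has_vector_derivative 0) (at x within {-2..0})" if "x \<in> {-2..0}" for x
    by (rule has_vector_derivative_transform[OF that _ has_vector_derivative_const]) (simp add: const_fun_def)
  then show "const_fun c \<in> DA" "opA (const_fun c) = (\<lambda>x. 0)"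
    using DA_I[OF const_fun_in_Ecar zero_in_Ecar, of c] by (auto simp: const_fun_def)
qed

lemma alg_simple_zero: "alg_simple_eigenvalue DA opA 0"
  unfolding alg_simple_eigenvalue_def
proof (intro conjI allI impI isolated_zero)
  have ne: "const_fun 1 \<noteq> (\<lambda>x. 0)" by (auto simp: const_fun_def fun_eq_iff intro!: exI[of _ 0])
  show "\<exists>f\<in>DA. f \<noteq> (\<lambda>x. 0) \<and> (\<forall>x. opA f x = 0 * f x)"
    using const_fun_in_DA ne by (intro bexI[of _ "const_fun 1"]) auto
  fix r :: real assume r: "r > 0" "cball 0 r \<inter> spectrum_op DA opA = {0}"
  show "\<exists>u\<in>Ecar. u \<noteq> (\<lambda>x. 0) \<and> (\<exists>f\<in>Ecar. spectral_proj DA opA 0 r f = u) \<and>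
      (\<forall>f\<in>Ecar. \<exists>c. spectral_proj DA opA 0 r f = (\<lambda>x. c * u x))"
  proof (intro bexI[of _ "const_fun 1"] conjI ballI ne const_fun_in_Ecar)
    show "spectral_proj DA opA 0 r (const_fun 1) = const_fun 1"
      by (simp add: spectral_proj_eq[OF r const_fun_in_Ecar] mass_const)
    fix f assume "f \<in> Ecar"
    then show "\<exists>c. spectral_proj DA opA 0 r f = (\<lambda>x. c * const_fun 1 x)"
      by (intro exI[of _ "mass f / 2"]) (auto simp: spectral_proj_eq[OF r] const_fun_def)
  qed
qed

lemma positive_proj_zero: "positive_spectral_proj DA opA 0"
  unfolding positive_spectral_proj_def positive_opE_def
proof (intro allI impI ballI)
  fix r :: real and f assume r: "r > 0" "cball 0 r \<inter> spectrum_op DA opA = {0}" and f: "f \<in> Eplus"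
  then have "spectral_proj DA opA 0 r f = const_fun (mass f / 2)"
    by (intro spectral_proj_eq) (auto simp: Eplus_def)
  then show "nonneg (spectral_proj DA opA 0 r f)"
    using mass_nonneg[OF f] by (simp add: nonneg_def const_fun_def)
qed

lemma spectral_bound_zero: "spectral_bound DA opA = 0"
proof (rule antisym)
  show "spectral_bound DA opA \<le> 0"
    unfolding spectral_bound_def spectrum_eq
  proof (rule SUP_least)
    fix z assume "z \<in> {\<mu>. char_fun \<mu> = 0}"
    then have "Re z \<le> 0" using char_fun_nonzero[of z] by fastforce
    then show "ereal (Re z) \<le> 0" by simp
  qed
  have "ereal (Re 0) \<le> spectral_bound DA opA"
    unfolding spectral_bound_def spectrum_eq by (rule SUP_upper) simp
  then show "0 \<le> spectral_bound DA opA" by (simp add: zero_ereal_def)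
qed

lemma dominant_zero: "dominant_spectral_bound DA opA"
  unfolding dominant_spectral_bound_def
proof (intro exI[of _ 0] conjI)
  show "spectral_bound DA opA = ereal 0" by (simp add: spectral_bound_zero zero_ereal_def)
  have "z = 0" if "char_fun z = 0" "Re z = 0" for z
    using char_fun_nonzero[of z] that by auto
  then show "spectrum_op DA opA \<inter> {z. Re z = 0} = {complex_of_real 0}"
    by (auto simp: spectrum_eq)
qed

lemma compact_resolvent_DA: "has_compact_resolvent DA opA"
  unfolding has_compact_resolvent_def
  using compact_resolvent[of 1] char_fun_nonzero[of 1]
  by (intro bexI[of _ 1]) (auto simp: resolvent_setE_eq)

theorem theorem9p8:
  shows "(\<exists>T. C0_semigroup T \<and> is_generator T DA opA)
    \<and> has_compact_resolvent DA opA
    \<and> spectral_bound DA opA = 0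
    \<and> dominant_spectral_bound DA opA
    \<and> alg_simple_eigenvalue DA opA 0
    \<and> positive_spectral_proj DA opA 0
    \<and> (\<forall>T. C0_semigroup T \<and> is_generator T DA opA \<longrightarrow>
          unif_asym_positive T (real_of_ereal (spectral_bound DA opA))
        \<and> \<not> (\<forall>t\<ge>0. positive_opE (T t))
        \<and> \<not> (\<exists>u. quasi_interior u \<and> indiv_ev_strongly_positive T u))"
  using C0_semigroup_semi is_generator_semi compact_resolvent_DA spectral_bound_zero dominant_zero
    alg_simple_zero positive_proj_zero semigroup_properties
  by (simp, blast)

end
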